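(* For any integers $0 \leq c < n$ there is a surjective function $$\mathbf{ct}: \mathbf{UQuad}_{\mathbb{A}}^c(n) \longrightarrow \mathcal{P}_1^c(n-c+1),$$ namely the function sending $q$ to its cycle type $\mathbf{ct}(q)$ (defined in the context), which is invariant under strong Gram congruence (that is, $\mathbf{ct}(q')=\mathbf{ct}(q)$ whenever $q,q' \in \mathbf{UQuad}_{\mathbb{A}}^c(n)$ and $q' \approx q$), and such that for any $q$ in $\mathbf{UQuad}_{\mathbb{A}}^c(n)$ the Coxeter polynomial of $q$ is $$\varphi_q(\lambda)=(\lambda-1)^{c-1}\,\mathrm{char}_{\mathbf{ct}(q)}(\lambda).$$
   Context: **Unit forms.** An integral quadratic form $q:\mathbb{Z}^n\to\mathbb{Z}$, $q(x)=\sum_{1\le i\le j\le n}q_{i,j}x_ix_j$ with $q_{i,j}\in\mathbb{Z}$, has upper triangular Gram matrix $\check{G}_q$, the unique upper triangular integer matrix with $q(x)=x^{\mathrm{tr}}\check{G}_qx$, and symmetric Gram matrix $G_q=\check{G}_q+\check{G}_q^{\mathrm{tr}}$. It is a unit form if all diagonal entries of $\check{G}_q$ equal $1$. Two unit forms are weakly Gram congruent, $q'\sim q$ (resp. strongly Gram congruent, $q'\approx q$), if $G_{q'}=B^{\mathrm{tr}}G_qB$ (resp. $\check{G}_{q'}=B^{\mathrm{tr}}\check{G}_qB$) for some $\mathbb{Z}$-invertible $n\times n$ matrix $B$. The form $q$ is non-negative ($q\ge 0$) if $q(x)\geq 0$ for all $x$; its corank $\mathbf{cork}(q)$ is $n-\mathrm{rank}(G_q)$;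 it is connected if the graph on $\{1,\ldots,n\}$ with an edge between $i<j$ whenever $q_{i,j}\neq 0$ is connected. A connected non-negative unit form $q$ of corank $c$ has Dynkin type $\mathbb{A}_r$, where $r=n-c$, if there is a $\mathbb{Z}$-invertible $B$ such that $q(Bx)=\sum_{i=1}^r x_i^2-\sum_{i=1}^{r-1}x_ix_{i+1}$ for all $x\in\mathbb{Z}^n$. For $0\le c<n$, $\mathbf{UQuad}_{\mathbb{A}}^c(n)$ is the set of connected non-negative unit forms in $n$ variables of corank $c$ and Dynkin type $\mathbb{A}_{n-c}$. **Coxeter polynomial.** $\varphi_q(\lambda)$ is the characteristic polynomial of the Coxeter matrix $\Phi_q=-\check{G}_q^{\mathrm{tr}}\check{G}_q^{-1}$. **Partitions.** A partition $\pi=(\pi_1,\ldots,\pi_{\ell(\pi)})$ of $m\ge 1$ ($\pi\vdash m$) is a non-increasing sequence of positive integers with sum $m$; $\ell(\pi)$ is its length. $\mathrm{char}_\pi(\lambda)=\prod_{a=1}^{\ell(\pi)}(\lambda^{\pi_a}-1)$. For $c\ge0$, $m\ge 1$, $\mathcal{P}_1^c(m)=\{\pi\vdash m \mid 0\le c-(\ell(\pi)-1)\equiv 0 \bmod 2\}$. (When $c=0$, the factor $(\lambda-1)^{-1}$ is read as division by $\lambda-1$.) **Quivers.** A quiver $Q=(Q_0,Q_1,\mathbf{s},\mathbf{t})$ consists of finite totally ordered sets $Q_0$ (vertices) and $Q_1$ (arrows) and functions $\mathbf{s},\mathbf{t}:Q_1\to Q_0$ (source, target). With $|Q_0|=m$,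 $|Q_1|=n$, its incidence matrix $I(Q)$ is the $m\times n$ matrix whose column for arrow $i$ is $\mathbf{e}_{\mathbf{s}(i)}-\mathbf{e}_{\mathbf{t}(i)}$. The form of $Q$ is $q_Q(x)=\frac12\|I(Q)x\|^2$, $x\in\mathbb{Z}^n$. $Q$ is loop-less if $\mathbf{s}(i)\ne\mathbf{t}(i)$ for all arrows $i$, and connected if its underlying graph is connected. **Permutation of vertices.** Let $Q$ be connected and loop-less with at least one arrow. For a vertex $v$, let $\alpha_Q^-(v)=(v_{-1},i_0,v_0,i_1,v_1,\ldots,i_\ell,v_\ell)$ be the walk with $v_{-1}=v$, $i_0$ the maximal arrow incident to $v$, $v_t$ the end-point of $i_t$ different from $v_{t-1}$, $i_{t+1}$ the maximal arrow among the arrows $j<i_t$ incident to $v_t$ (for $t=0,\ldots,\ell-1$), stopping at $v_\ell$ when no arrow $j<i_\ell$ is incident to $v_\ell$. Put $\xi_Q^-(v)=v_\ell$. Then $\xi_Q^-$ is a permutation of $Q_0$. The cycle type $\mathbf{ct}(Q)$ is the partition of $|Q_0|$ given by the cardinalities of the orbits of $\xi_Q^-$, ordered non-increasingly. **Cycle type of a form.** It is known that $\mathbf{UQuad}_{\mathbb{A}}^c(n)$ is exactly the set of forms $q_Q$ for $Q$ a connected loop-less quiver with $n$ arrows and $m=n-c+1$ vertices. For $q\in\mathbf{UQuad}_{\mathbb{A}}^c(n)$ put $\mathbf{ct}(q):=\mathbf{ct}(Q)$ for any such $Q$ with $q=q_Q$; this does not depend on the choice of $Q$. *)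

theory Defs
  imports
    "Jordan_Normal_Form.Char_Poly"
    "Jordan_Normal_Form.DL_Rank"
    "Graph_Theory.Digraph_Component"
    "HOL-Combinatorics.Orbits"
begin

section \<open>Unit forms\<close>

text \<open>
  Forms in \<open>n\<close> variables are functions on \<open>carrier_vec n\<close>, extended by \<open>undefined\<close> so that
  equality of functions is equality of forms. Indices start at \<open>0\<close>.
\<close>

definition integral_form :: "nat \<Rightarrow> (int vec \<Rightarrow> int) \<Rightarrow> bool" where
  "integral_form n q \<longleftrightarrow>
     (\<exists>a :: nat \<Rightarrow> nat \<Rightarrow> int.
        q = (\<lambda>x\<in>carrier_vec n. \<Sum>i<n. \<Sum>j\<in>{i..<n}. a i j * x $ i * x $ j))"

definition tri_gram :: "nat \<Rightarrow> (int vec \<Rightarrow> int) \<Rightarrow> int mat" where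
  "tri_gram n q =
     (THE G. G \<in> carrier_mat n n \<and> upper_triangular G \<and>
        (\<forall>x\<in>carrier_vec n. q x = x \<bullet> (G *\<^sub>v x)))"

definition sym_gram :: "nat \<Rightarrow> (int vec \<Rightarrow> int) \<Rightarrow> int mat" where
  "sym_gram n q = tri_gram n q + (tri_gram n q)\<^sup>T"

definition unit_form :: "nat \<Rightarrow> (int vec \<Rightarrow> int) \<Rightarrow> bool" where
  "unit_form n q \<longleftrightarrow> integral_form n q \<and> (\<forall>i<n. tri_gram n q $$ (i, i) = 1)"

definition strongly_congruent :: "nat \<Rightarrow> (int vec \<Rightarrow> int) \<Rightarrow> (int vec \<Rightarrow> int) \<Rightarrow> bool" where
  "strongly_congruent n q' q \<longleftrightarrow>
     (\<exists>B \<in> carrier_mat n n. invertible_mat B \<and> tri_gram n q' = B\<^sup>T * tri_gram n q * B)"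

definition nonneg_form :: "nat \<Rightarrow> (int vec \<Rightarrow> int) \<Rightarrow> bool" where
  "nonneg_form n q \<longleftrightarrow> (\<forall>x\<in>carrier_vec n. 0 \<le> q x)"

definition corank :: "nat \<Rightarrow> (int vec \<Rightarrow> int) \<Rightarrow> nat" where
  "corank n q = n - vec_space.rank n (map_mat rat_of_int (sym_gram n q))"

definition form_graph :: "nat \<Rightarrow> (int vec \<Rightarrow> int) \<Rightarrow> (nat, nat \<times> nat) pre_digraph" where
  "form_graph n q =
     \<lparr> verts = {0..<n},
       arcs = {(i, j). i < j \<and> j < n \<and> tri_gram n q $$ (i, j) \<noteq> 0},
       tail = fst, head = snd \<rparr>"

definition connected_form :: "nat \<Rightarrow> (int vec \<Rightarrow> int) \<Rightarrow> bool" where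
  "connected_form n q \<longleftrightarrow> Digraph_Component.connected (form_graph n q)"

definition dynkin_type_A :: "nat \<Rightarrow> nat \<Rightarrow> (int vec \<Rightarrow> int) \<Rightarrow> bool" where
  "dynkin_type_A n r q \<longleftrightarrow>
     (\<exists>B \<in> carrier_mat n n. invertible_mat B \<and>
        (\<forall>x\<in>carrier_vec n.
           q (B *\<^sub>v x) = (\<Sum>i<r. (x $ i)\<^sup>2) - (\<Sum>i<r - 1. x $ i * x $ Suc i)))"

definition UQuad_A :: "nat \<Rightarrow> nat \<Rightarrow> (int vec \<Rightarrow> int) set" where
  "UQuad_A c n =
     {q. unit_form n q \<and> connected_form n q \<and> nonneg_form n q \<and>
         corank n q = c \<and> dynkin_type_A n (n - c) q}"


section \<open>Coxeter polynomial\<close>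

definition mat_inv :: "int mat \<Rightarrow> int mat" where
  "mat_inv A =
     (THE B. B \<in> carrier_mat (dim_col A) (dim_row A) \<and> inverts_mat A B \<and> inverts_mat B A)"

definition coxeter_mat :: "nat \<Rightarrow> (int vec \<Rightarrow> int) \<Rightarrow> int mat" where
  "coxeter_mat n q = - ((tri_gram n q)\<^sup>T * mat_inv (tri_gram n q))"

definition coxeter_poly :: "nat \<Rightarrow> (int vec \<Rightarrow> int) \<Rightarrow> int poly" where
  "coxeter_poly n q = char_poly (coxeter_mat n q)"


section \<open>Partitions\<close>

definition partition_of :: "nat \<Rightarrow> nat list \<Rightarrow> bool" where
  "partition_of m \<pi> \<longleftrightarrow> sorted_wrt (\<ge>) \<pi> \<and> (\<forall>k\<in>set \<pi>. 0 < k) \<and> sum_list \<pi> = m"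

definition char_partition :: "nat list \<Rightarrow> int poly" where
  "char_partition \<pi> = (\<Prod>a<length \<pi>. monom 1 (\<pi> ! a) - 1)"

definition P1 :: "nat \<Rightarrow> nat \<Rightarrow> nat list set" where
  "P1 c m =
     {\<pi>. partition_of m \<pi> \<and>
         0 \<le> int c - (int (length \<pi>) - 1) \<and> even (int c - (int (length \<pi>) - 1))}"


section \<open>Quivers\<close>

text \<open>
  Vertices and arrows are finite sets of elements of linearly ordered types; source and target
  are \<^const>\<open>tail\<close> and \<^const>\<open>head\<close>.
\<close>

definition conn_loopless_quiver :: "('v :: linorder, 'a :: linorder) pre_digraph \<Rightarrow> bool" where
  "conn_loopless_quiver Q \<longleftrightarrow>
     fin_digraph Q \<and> loopfree_digraph Q \<and> Digraph_Component.connected Q"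

text \<open>Rows and columns are indexed by the vertices and the arrows in increasing order.\<close>

definition incidence_mat :: "('v :: linorder, 'a :: linorder) pre_digraph \<Rightarrow> int mat" where
  "incidence_mat Q =
     mat (card (verts Q)) (card (arcs Q))
       (\<lambda>(k, l). let v = sorted_list_of_set (verts Q) ! k; i = sorted_list_of_set (arcs Q) ! l
                 in of_bool (tail Q i = v) - of_bool (head Q i = v))"

text \<open>The division by \<open>2\<close> is exact, as the entries of \<open>I(Q)x\<close> add up to \<open>0\<close>.\<close>

definition quiver_form :: "('v :: linorder, 'a :: linorder) pre_digraph \<Rightarrow> int vec \<Rightarrow> int" where
  "quiver_form Q =
     (\<lambda>x\<in>carrier_vec (card (arcs Q)).
        ((incidence_mat Q *\<^sub>v x) \<bullet> (incidence_mat Q *\<^sub>v x)) div 2)"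

definition incident_arrows :: "('v, 'a) pre_digraph \<Rightarrow> 'v \<Rightarrow> 'a set" where
  "incident_arrows Q v = {i \<in> arcs Q. tail Q i = v \<or> head Q i = v}"

definition other_end :: "('v, 'a) pre_digraph \<Rightarrow> 'a \<Rightarrow> 'v \<Rightarrow> 'v" where
  "other_end Q i v = (if tail Q i = v then head Q i else tail Q i)"

text \<open>
  A walk \<open>(v\<^sub>-\<^sub>1, i\<^sub>0, v\<^sub>0, \<dots>, i\<^sub>l, v\<^sub>l)\<close> is represented by the list
  \<open>[(i\<^sub>0, v\<^sub>0), \<dots>, (i\<^sub>l, v\<^sub>l)]\<close>. The function \<open>descend Q i v\<close> is the
  continuation of a walk whose last arrow is \<open>i\<close> and whose last vertex is \<open>v\<close>. The finiteness
  test, which is true for quivers, makes it a total function.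
\<close>

function descend ::
  "('v, 'a :: linorder) pre_digraph \<Rightarrow> 'a \<Rightarrow> 'v \<Rightarrow> ('a \<times> 'v) list" where
  "descend Q i v =
     (if finite (arcs Q) \<and> {j \<in> incident_arrows Q v. j < i} \<noteq> {}
      then let j = Max {j \<in> incident_arrows Q v. j < i}; w = other_end Q j v
           in (j, w) # descend Q j w
      else [])"
  by pat_completeness auto

termination
proof (relation "measure (\<lambda>(Q, i, v). card {j \<in> arcs Q. j < i})", goal_cases)
  case 1
  then show ?case by simp
next
  case (2 Q i v j w)
  let ?J = "{j \<in> incident_arrows Q v. j < i}"
  from 2 have "finite ?J" "?J \<noteq> {}"
    by (auto simp: incident_arrows_def)
  then have "j \<in> ?J"
    using 2 Max_in by blast
  then have "j \<in> arcs Q" "j < i"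
    by (auto simp: incident_arrows_def)
  with 2 have "{k \<in> arcs Q. k < j} \<subset> {k \<in> arcs Q. k < i}" "finite {k \<in> arcs Q. k < i}"
    by auto
  then show ?case
    by (simp add: psubset_card_mono)
qed

declare descend.simps [simp del]

definition descending_walk ::
  "('v, 'a :: linorder) pre_digraph \<Rightarrow> 'v \<Rightarrow> ('a \<times> 'v) list" where
  "descending_walk Q v =
     (let i = Max (incident_arrows Q v); w = other_end Q i v in (i, w) # descend Q i w)"

definition xi :: "('v, 'a :: linorder) pre_digraph \<Rightarrow> 'v \<Rightarrow> 'v" where
  "xi Q v = snd (last (descending_walk Q v))"

definition quiver_cycle_type :: "('v :: linorder, 'a :: linorder) pre_digraph \<Rightarrow> nat list" where
  "quiver_cycle_type Q =
     rev (sorted_list_of_multiset (image_mset card (mset_set (orbit (xi Q) ` verts Q))))"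

text \<open>
  Every finite totally ordered set is isomorphic to a finite set of natural numbers, so it
  suffices to let \<open>Q\<close> range over quivers with vertices and arrows in \<^typ>\<open>nat\<close>.
\<close>

definition cycle_type :: "nat \<Rightarrow> (int vec \<Rightarrow> int) \<Rightarrow> nat list" where
  "cycle_type n q =
     (THE \<pi>. \<exists>Q :: (nat, nat) pre_digraph.
        conn_loopless_quiver Q \<and> card (arcs Q) = n \<and> card (verts Q) = n - corank n q + 1 \<and>
        quiver_form Q = q \<and> \<pi> = quiver_cycle_type Q)"

end

theory Submission
  imports Defs "HOL-Combinatorics.Cycles"
begin

text \<open>
  Let \<open>Q\<close> be a connected loop-less quiver with \<open>m\<close> vertices and \<open>n\<close> arrows, let \<open>A\<close> be its
  incidence matrix and \<open>U\<close> the upper triangular Gram matrix of its form, so that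
  \<open>A\<^sup>T A = U + U\<^sup>T\<close>. The Coxeter matrix is then \<open>\<Phi> = 1 - A\<^sup>T (A U\<^sup>-\<^sup>1)\<close>. Exchanging the two factors
  turns this \<open>n \<times> n\<close> matrix into the \<open>m \<times> m\<close> matrix \<open>\<Lambda> = 1 - (A U\<^sup>-\<^sup>1) A\<^sup>T\<close>, and Sylvester's
  determinant identity relates the two characteristic polynomials
  (\<open>char_poly_one_minus_swap\<close>). The matrix \<open>\<Lambda>\<close> is the product of the reflections in the
  columns of \<open>A\<close>, taken in the order of the arrows (\<open>gram_tri_walk_mat\<close>,
  \<open>inc_mat_walk_mat\<close>). The reflection in \<open>e\<^sub>s - e\<^sub>t\<close> permutes the standard basis by the
  transposition of \<open>s\<close> and \<open>t\<close>, and a descending walk carries out these transpositions from the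
  largest arrow downwards (\<open>xi_eq_swaps\<close>). So \<open>\<Lambda>\<close> is the permutation matrix of \<open>\<xi>\<close>, and its
  characteristic polynomial is the product of \<open>\<lambda>\<^sup>k - 1\<close> over the orbit sizes \<open>k\<close>. This gives
  \<open>(\<lambda> - 1)\<^sup>m \<phi> = (\<lambda> - 1)\<^sup>n char\<^sub>c\<^sub>t\<close> (\<open>coxeter_poly_quiver_form\<close>), which is the formula for the
  Coxeter polynomial, as \<open>n - m = c - 1\<close>.

  The polynomial \<open>char\<^sub>\<pi>\<close> determines \<open>\<pi>\<close> (\<open>char_partition_inject\<close>). Hence the Coxeter polynomial of
  a form determines the cycle type. This proves that the cycle type does not depend on the
  quiver, and that it is invariant under strong congruence, since strongly congruent forms have
  similar Coxeter matrices.

  That every form of type \<open>\<bbbA>\<close> is the form of a quiver follows by transporting the incidence matrix of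
  a path along the base change to the Dynkin form (\<open>UQuad_A_quiver\<close>): the columns of the
  resulting matrix have norm two and entries adding up to zero, so they are differences of two
  standard basis vectors. The cycle type lies in the given set of partitions because the Coxeter
  polynomial takes the value \<open>1\<close> at \<open>0\<close>, which fixes the parity of the number of cycles, and
  because the differences along the arrows of functions on the vertices are orthogonal to a
  second space of vectors that comes from the functions constant on the cycles
  (\<open>vertices_plus_orbits_le\<close>). For surjectivity, a path through all vertices, followed by arrows
  joining the last vertices of consecutive blocks, realises any prescribed list of block
  sizes (\<open>swaps_partition_edges\<close>), and pairs of parallel arrows adjust the corank.
\<close>

section \<open>Exchanging the factors of a matrix product\<close>

text \<open>
  Sylvester's identity, homogenised in \<open>t\<close> to avoid divisions. Block column operations and block
  row operations on one and the same block matrix produce the two sides.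
\<close>

lemma det_swap_factors:
  fixes A B :: "'a :: idom mat"
  assumes A: "A \<in> carrier_mat n m" and B: "B \<in> carrier_mat m n"
  shows "t ^ m * det (t \<cdot>\<^sub>m 1\<^sub>m n + A * B) = t ^ n * det (t \<cdot>\<^sub>m 1\<^sub>m m + B * A)"
proof -
  let ?M = "four_block_mat (t \<cdot>\<^sub>m 1\<^sub>m n) (- A) B (1\<^sub>m m)"
  let ?L = "four_block_mat (1\<^sub>m n) (0\<^sub>m n m) (- B) (t \<cdot>\<^sub>m 1\<^sub>m m)"
  let ?R = "four_block_mat (1\<^sub>m n) (0\<^sub>m n m) (- B) (1\<^sub>m m)"
  have M: "?M \<in> carrier_mat (n + m) (n + m)" and L: "?L \<in> carrier_mat (n + m) (n + m)"
    and R: "?R \<in> carrier_mat (n + m) (n + m)"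
    using A B by auto
  have MR: "?M * ?R = four_block_mat (t \<cdot>\<^sub>m 1\<^sub>m n + A * B) (- A) (0\<^sub>m m n) (1\<^sub>m m)"
  proof -
    have "(t \<cdot>\<^sub>m 1\<^sub>m n) * 1\<^sub>m n + (- A) * (- B) = t \<cdot>\<^sub>m 1\<^sub>m n + A * B"
      "(t \<cdot>\<^sub>m 1\<^sub>m n) * 0\<^sub>m n m + (- A) * 1\<^sub>m m = - A"
      "B * 1\<^sub>m n + 1\<^sub>m m * (- B) = 0\<^sub>m m n" "B * 0\<^sub>m n m + 1\<^sub>m m * 1\<^sub>m m = 1\<^sub>m m"
      using A B by auto
    then show ?thesis
      using A B by (subst mult_four_block_mat[of _ n n _ m _ m _ _ n _ m]) simp_all
  qed
  have LM: "?L * ?M = four_block_mat (t \<cdot>\<^sub>m 1\<^sub>m n) (- A) (0\<^sub>m m n) (t \<cdot>\<^sub>m 1\<^sub>m m + B * A)"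
  proof -
    have "1\<^sub>m n * (t \<cdot>\<^sub>m 1\<^sub>m n) + 0\<^sub>m n m * B = t \<cdot>\<^sub>m 1\<^sub>m n" "1\<^sub>m n * (- A) + 0\<^sub>m n m * 1\<^sub>m m = - A"
      using A B by auto
    moreover have "(- B) * (t \<cdot>\<^sub>m 1\<^sub>m n) + (t \<cdot>\<^sub>m 1\<^sub>m m) * B = 0\<^sub>m m n"
    proof -
      have "(- B) * (t \<cdot>\<^sub>m 1\<^sub>m n) = t \<cdot>\<^sub>m (- B)"
        using B by (subst mult_smult_distrib[of _ m n _ n]) simp_all
      moreover have "(t \<cdot>\<^sub>m 1\<^sub>m m) * B = t \<cdot>\<^sub>m B"
        using B by (subst mult_smult_assoc_mat[of _ m m _ n]) simp_all
      ultimately show ?thesis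
        using B by (intro eq_matI) auto
    qed
    moreover have "(- B) * (- A) + (t \<cdot>\<^sub>m 1\<^sub>m m) * 1\<^sub>m m = t \<cdot>\<^sub>m 1\<^sub>m m + B * A"
    proof -
      have "(- B) * (- A) = B * A" "(t \<cdot>\<^sub>m 1\<^sub>m m) * 1\<^sub>m m = t \<cdot>\<^sub>m (1\<^sub>m m :: 'a mat)"
        using A B by auto
      then show ?thesis
        using A B comm_add_mat[of "B * A" m m "t \<cdot>\<^sub>m 1\<^sub>m m"] by simp
    qed
    ultimately show ?thesis
      using A B by (subst mult_four_block_mat[of _ n n _ m _ m _ _ n _ m]) simp_all
  qed
  have "det ?M * det ?R = det (t \<cdot>\<^sub>m 1\<^sub>m n + A * B)"
    unfolding det_mult[OF M R, symmetric] MR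
    using A B by (subst det_four_block_mat_lower_left_zero[of _ n _ m]) auto
  moreover have "det ?R = 1"
    using B by (subst det_four_block_mat_upper_right_zero[of _ n _ m]) auto
  moreover have "det ?L * det ?M = t ^ n * det (t \<cdot>\<^sub>m 1\<^sub>m m + B * A)"
    unfolding det_mult[OF L M, symmetric] LM
    using A B by (subst det_four_block_mat_lower_left_zero[of _ n _ m]) auto
  moreover have "det ?L = t ^ m"
    using B by (subst det_four_block_mat_upper_right_zero[of _ n _ m]) auto
  ultimately show ?thesis by simp
qed

text \<open>
  The characteristic matrix of \<open>1 - X Y\<close> is \<open>(x - 1) 1 + X Y\<close>.
\<close>

lemma char_poly_one_minus_swap:
  fixes A B :: "int mat"
  assumes A: "A \<in> carrier_mat n m" and B: "B \<in> carrier_mat m n"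
  shows "[:-1, 1:] ^ m * char_poly (1\<^sub>m n - A * B) = [:-1, 1:] ^ n * char_poly (1\<^sub>m m - B * A)"
proof -
  interpret h: comm_ring_hom "\<lambda>a :: int. [:a:]"
    by unfold_locales (auto simp: pCons_one)
  have cm: "char_poly_matrix (1\<^sub>m k - C * D) =
      [:-1, 1:] \<cdot>\<^sub>m 1\<^sub>m k + map_mat (\<lambda>a. [:a:]) C * map_mat (\<lambda>a. [:a:]) D"
    if C: "C \<in> carrier_mat k l" and D: "D \<in> carrier_mat l k" for C D :: "int mat" and k l
  proof -
    have "map_mat (\<lambda>a. [:a:]) C * map_mat (\<lambda>a. [:a:]) D = map_mat (\<lambda>a. [:a:]) (C * D)"
      using h.mat_hom_mult[OF C D] by simp
    then show ?thesis
      using C D by (intro eq_matI) (auto simp: char_poly_matrix_def)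
  qed
  show ?thesis
    unfolding char_poly_def cm[OF A B] cm[OF B A]
    by (rule det_swap_factors) (use A B in auto)
qed

section \<open>Gram matrices of integral forms\<close>

lemma scalar_prod_mult_mat_vec:
  fixes G :: "'a :: comm_semiring_0 mat"
  assumes "G \<in> carrier_mat n n" "x \<in> carrier_vec n"
  shows "x \<bullet> (G *\<^sub>v x) = (\<Sum>i<n. \<Sum>j<n. G $$ (i, j) * x $ i * x $ j)"
  using assms by (auto simp: scalar_prod_def sum_distrib_left atLeast0LessThan ac_simps intro!: sum.cong)

lemma scalar_prod_unit_mat:
  fixes G :: "int mat"
  assumes G: "G \<in> carrier_mat n n" and "i < n" "j < n"
  shows "unit_vec n i \<bullet> (G *\<^sub>v unit_vec n j) = G $$ (i, j)"
  using assms by (simp add: scalar_prod_left_unit[of _ n])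

lemma scalar_prod_polarize:
  fixes G :: "int mat"
  assumes G: "G \<in> carrier_mat n n" and x: "x \<in> carrier_vec n" and y: "y \<in> carrier_vec n"
  shows "(x + y) \<bullet> (G *\<^sub>v (x + y)) - x \<bullet> (G *\<^sub>v x) - y \<bullet> (G *\<^sub>v y)
    = x \<bullet> (G *\<^sub>v y) + y \<bullet> (G *\<^sub>v x)"
proof -
  have "G *\<^sub>v (x + y) = G *\<^sub>v x + G *\<^sub>v y"
    using assms by (rule mult_add_distrib_mat_vec)
  then show ?thesis
    using assms by (simp add: add_scalar_prod_distrib[of _ n] scalar_prod_add_distrib[of _ n])
qed

lemma scalar_prod_gram:
  fixes A :: "int mat"
  assumes A: "A \<in> carrier_mat m n" and x: "x \<in> carrier_vec n"
  shows "x \<bullet> ((A\<^sup>T * A) *\<^sub>v x) = (A *\<^sub>v x) \<bullet> (A *\<^sub>v x)"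
  using A x transpose_vec_mult_scalar[OF A x, of "A *\<^sub>v x"]
  by (simp add: assoc_mult_mat_vec[of _ n m _ n] comm_scalar_prod[of _ n])

text \<open>
  Polarisation recovers \<open>G + G\<^sup>T\<close> from the form, and an upper triangular \<open>G\<close> can be read off
  from this sum.
\<close>

lemma tri_gram_unique:
  assumes G: "G \<in> carrier_mat n n" "upper_triangular G"
    and q: "\<And>x. x \<in> carrier_vec n \<Longrightarrow> q x = x \<bullet> (G *\<^sub>v x)"
  shows "tri_gram n q = G"
  unfolding tri_gram_def
proof (rule the_equality)
  show "G \<in> carrier_mat n n \<and> upper_triangular G \<and> (\<forall>x\<in>carrier_vec n. q x = x \<bullet> (G *\<^sub>v x))"
    using assms by blast
next
  fix H assume H: "H \<in> carrier_mat n n \<and> upper_triangular H \<and>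
    (\<forall>x\<in>carrier_vec n. q x = x \<bullet> (H *\<^sub>v x))"
  have eq: "x \<bullet> (H *\<^sub>v x) = x \<bullet> (G *\<^sub>v x)" if "x \<in> carrier_vec n" for x
    using H q that by auto
  have sym: "H $$ (i, j) + H $$ (j, i) = G $$ (i, j) + G $$ (j, i)" if ij: "i < n" "j < n" for i j
  proof -
    have u: "unit_vec n i \<in> carrier_vec n" "unit_vec n j \<in> carrier_vec n"
      by auto
    have "x \<bullet> (H *\<^sub>v y) + y \<bullet> (H *\<^sub>v x) = x \<bullet> (G *\<^sub>v y) + y \<bullet> (G *\<^sub>v x)"
      if "x \<in> carrier_vec n" "y \<in> carrier_vec n" for x y
      using scalar_prod_polarize[of H n x y] scalar_prod_polarize[of G n x y] that H G
        eq[of x] eq[of y] eq[of "x + y"] by simp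
    from this[OF u] show ?thesis
      using ij H G by (simp only: scalar_prod_unit_mat)
  qed
  show "H = G"
  proof (rule eq_matI)
    fix i j assume "i < dim_row G" "j < dim_col G"
    then have ij: "i < n" "j < n" using G by auto
    consider "i = j" | "j < i" | "i < j" by linarith
    then show "H $$ (i, j) = G $$ (i, j)"
    proof cases
      case 1
      then show ?thesis using sym[of i i] ij by simp
    next
      case 2
      then have "H $$ (i, j) = 0" "G $$ (i, j) = 0"
        using upper_triangularD[of H j i] upper_triangularD[of G j i] H G ij by auto
      then show ?thesis by simp
    next
      case 3
      then have "H $$ (j, i) = 0" "G $$ (j, i) = 0"
        using upper_triangularD[of H i j] upper_triangularD[of G i j] H G ij by auto
      then show ?thesis using sym[OF ij] by simp
    qed
  qed (use H G in auto)
qed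

lemma tri_gram_integral_form:
  assumes "integral_form n q"
  shows "tri_gram n q \<in> carrier_mat n n" "upper_triangular (tri_gram n q)"
    "\<And>x. x \<in> carrier_vec n \<Longrightarrow> q x = x \<bullet> (tri_gram n q *\<^sub>v x)"
proof -
  obtain a :: "nat \<Rightarrow> nat \<Rightarrow> int" where
    a: "q = (\<lambda>x\<in>carrier_vec n. \<Sum>i<n. \<Sum>j\<in>{i..<n}. a i j * x $ i * x $ j)"
    using assms by (auto simp: integral_form_def)
  define G where "G = mat n n (\<lambda>(i, j). if i \<le> j then a i j else 0)"
  have G: "G \<in> carrier_mat n n" "upper_triangular G"
    by (auto simp: G_def intro!: upper_triangularI)
  moreover have qG: "q x = x \<bullet> (G *\<^sub>v x)" if x: "x \<in> carrier_vec n" for x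
  proof -
    have "(\<Sum>j<n. G $$ (i, j) * x $ i * x $ j) = (\<Sum>j\<in>{i..<n}. a i j * x $ i * x $ j)" if "i < n" for i
      using that by (intro sum.mono_neutral_cong_right) (auto simp: G_def)
    then show ?thesis
      using x G by (simp add: a scalar_prod_mult_mat_vec)
  qed
  ultimately have "tri_gram n q = G"
    by (rule tri_gram_unique)
  then show "tri_gram n q \<in> carrier_mat n n" "upper_triangular (tri_gram n q)"
    "\<And>x. x \<in> carrier_vec n \<Longrightarrow> q x = x \<bullet> (tri_gram n q *\<^sub>v x)"
    using G qG by auto
qed

lemma integral_formI:
  assumes G: "G \<in> carrier_mat n n" "upper_triangular G"
    and q: "q \<in> extensional (carrier_vec n)" "\<And>x. x \<in> carrier_vec n \<Longrightarrow> q x = x \<bullet> (G *\<^sub>v x)"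
  shows "integral_form n q"
proof -
  have "q = (\<lambda>x\<in>carrier_vec n. \<Sum>i<n. \<Sum>j\<in>{i..<n}. G $$ (i, j) * x $ i * x $ j)"
  proof (rule extensionalityI[OF q(1) restrict_extensional])
    fix x :: "int vec" assume x: "x \<in> carrier_vec n"
    have "(\<Sum>j<n. G $$ (i, j) * x $ i * x $ j) = (\<Sum>j\<in>{i..<n}. G $$ (i, j) * x $ i * x $ j)"
      if "i < n" for i
      using that G upper_triangularD[of G _ i] by (intro sum.mono_neutral_cong_right) auto
    then show "q x = (\<lambda>x\<in>carrier_vec n. \<Sum>i<n. \<Sum>j\<in>{i..<n}. G $$ (i, j) * x $ i * x $ j) x"
      using x G by (simp add: q scalar_prod_mult_mat_vec)
  qed
  then show ?thesis
    unfolding integral_form_def by (rule exI[of _ "\<lambda>i j. G $$ (i, j)"])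
qed

text \<open>
  The adjugate matrix is an inverse over the integers.
\<close>

lemma mat_inv_unimodular:
  assumes U: "U \<in> carrier_mat n n" and det: "det U = 1"
  shows "mat_inv U \<in> carrier_mat n n" "U * mat_inv U = 1\<^sub>m n" "mat_inv U * U = 1\<^sub>m n"
proof -
  let ?P = "\<lambda>B. B \<in> carrier_mat (dim_col U) (dim_row U) \<and> inverts_mat U B \<and> inverts_mat B U"
  have adj: "adj_mat U \<in> carrier_mat n n" "U * adj_mat U = 1\<^sub>m n" "adj_mat U * U = 1\<^sub>m n"
    using adj_mat[OF U] det by auto
  have "?P (adj_mat U)"
    using adj U by (auto simp: inverts_mat_def)
  moreover have "B = adj_mat U" if "?P B" for B
  proof -
    have B: "B \<in> carrier_mat n n" "B * U = 1\<^sub>m n"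
      using that U by (auto simp: inverts_mat_def)
    have "B = B * (U * adj_mat U)" using B adj by simp
    also have "\<dots> = B * U * adj_mat U"
      by (rule assoc_mult_mat[OF B(1) U adj(1), symmetric])
    finally show ?thesis using B adj by simp
  qed
  ultimately have "mat_inv U = adj_mat U"
    unfolding mat_inv_def by (rule the_equality)
  then show "mat_inv U \<in> carrier_mat n n" "U * mat_inv U = 1\<^sub>m n" "mat_inv U * U = 1\<^sub>m n"
    using adj by auto
qed

lemma det_unitriangular:
  fixes U :: "int mat"
  assumes U: "U \<in> carrier_mat n n" "upper_triangular U" and diag: "\<And>i. i < n \<Longrightarrow> U $$ (i, i) = 1"
  shows "det U = 1"
proof -
  have "diag_mat U = replicate n 1"
    using U diag by (auto simp: diag_mat_def intro!: nth_equalityI)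
  then show ?thesis
    using det_upper_triangular[OF U(2,1)] by simp
qed

section \<open>Products of transpositions and the Coxeter matrix\<close>

text \<open>
  The last edge of the list acts first, just as a descending walk starts with the largest arrow.
\<close>

fun swaps :: "('v \<times> 'v) list \<Rightarrow> 'v \<Rightarrow> 'v" where
  "swaps [] = id"
| "swaps (e # es) = Transposition.transpose (fst e) (snd e) \<circ> swaps es"

lemma swaps_append: "swaps (xs @ ys) = swaps xs \<circ> swaps ys"
  by (induction xs) (auto simp: fun_eq_iff)

lemma swaps_drop:
  assumes "j < length es"
  shows "swaps (drop j es) x = Transposition.transpose (fst (es ! j)) (snd (es ! j)) (swaps (drop (Suc j) es) x)"
  by (simp add: Cons_nth_drop_Suc[OF assms, symmetric])

definition edges_on :: "'v set \<Rightarrow> ('v \<times> 'v) list \<Rightarrow> bool" where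
  "edges_on V es \<longleftrightarrow> (\<forall>e\<in>set es. fst e \<in> V \<and> snd e \<in> V \<and> fst e \<noteq> snd e)"

lemma edges_on_nth:
  assumes "edges_on V es" "i < length es"
  shows "fst (es ! i) \<in> V" "snd (es ! i) \<in> V" "fst (es ! i) \<noteq> snd (es ! i)"
  using assms by (auto simp: edges_on_def)

lemma swaps_permutes:
  assumes "edges_on V es"
  shows "swaps es permutes V"
  using assms
proof (induction es)
  case Nil
  show ?case unfolding swaps.simps by (rule permutes_id)
next
  case (Cons e es)
  then show ?case
    unfolding swaps.simps edges_on_def by (intro permutes_compose permutes_swap_id) auto
qed

text \<open>
  The column of the incidence matrix that belongs to an edge, as a function on the vertices.
\<close>

definition edge_vec :: "'v \<times> 'v \<Rightarrow> 'v \<Rightarrow> int" where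
  "edge_vec e v = of_bool (fst e = v) - of_bool (snd e = v)"

text \<open>
  The scalar product of two such columns, in a form that does not mention the set of vertices.
\<close>

definition edge_dot :: "'v \<times> 'v \<Rightarrow> 'v \<times> 'v \<Rightarrow> int" where
  "edge_dot e f = edge_vec e (fst f) - edge_vec e (snd f)"

lemma edge_dot_self: "fst e \<noteq> snd e \<Longrightarrow> edge_dot e e = 2"
  by (simp add: edge_dot_def edge_vec_def)

lemma sum_edge_vec:
  assumes "finite V" "fst f \<in> V" "snd f \<in> V"
  shows "(\<Sum>v\<in>V. g v * edge_vec f v) = g (fst f) - g (snd f)"
  using assms
  by (simp add: edge_vec_def right_diff_distrib sum_subtractf of_bool_def if_distrib[of "(*) _"] cong: if_cong)

text \<open>
  This and the next lemma are the identity \<open>1 - s = u u\<^sup>T\<close> for the reflection \<open>s\<close> in a vector \<open>u\<close> of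
  norm two. For \<open>u = e\<^sub>a - e\<^sub>b\<close> the reflection acts on the basis vectors as the transposition
  of \<open>a\<close> and \<open>b\<close>.
\<close>

lemma reflection_point:
  assumes "fst e \<noteq> snd e"
  shows "of_bool (v = x) - of_bool (v = Transposition.transpose (fst e) (snd e) x) = edge_vec e v * edge_vec e x"
  using assms by (auto simp: edge_vec_def transpose_def)

lemma reflection_edge:
  assumes "fst e \<noteq> snd e"
  shows "edge_vec f x - edge_vec f (Transposition.transpose (fst e) (snd e) x) = edge_dot f e * edge_vec e x"
  using assms by (auto simp: edge_vec_def edge_dot_def transpose_def)

definition inc_mat :: "'v list \<Rightarrow> ('v \<times> 'v) list \<Rightarrow> int mat" where
  "inc_mat vs es = mat (length vs) (length es) (\<lambda>(k, l). edge_vec (es ! l) (vs ! k))"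

definition gram_tri :: "('v \<times> 'v) list \<Rightarrow> int mat" where
  "gram_tri es = mat (length es) (length es)
     (\<lambda>(i, j). if i = j then 1 else if i < j then edge_dot (es ! i) (es ! j) else 0)"

definition fun_mat :: "('v \<Rightarrow> 'w) \<Rightarrow> 'w list \<Rightarrow> 'v list \<Rightarrow> int mat" where
  "fun_mat f ws vs = mat (length ws) (length vs) (\<lambda>(k, l). of_bool (ws ! k = f (vs ! l)))"

text \<open>
  Row \<open>j\<close> is \<open>u\<^sub>j\<^sup>T s\<^sub>j\<^sub>+\<^sub>1 \<dots> s\<^sub>n\<^sub>-\<^sub>1\<close>, where \<open>s\<^sub>i\<close> is the reflection in the column \<open>u\<^sub>i\<close> of the
  incidence matrix \<open>A\<close>. This is what back substitution gives for \<open>U\<^sup>-\<^sup>1 A\<^sup>T\<close>, where \<open>U\<close> is the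
  upper triangular Gram matrix.
\<close>

definition walk_mat :: "'v list \<Rightarrow> ('v \<times> 'v) list \<Rightarrow> int mat" where
  "walk_mat vs es = mat (length es) (length vs)
     (\<lambda>(j, k). edge_vec (es ! j) (swaps (drop (Suc j) es) (vs ! k)))"

lemma carrier_graph_mats [simp]:
  "inc_mat vs es \<in> carrier_mat (length vs) (length es)"
  "gram_tri es \<in> carrier_mat (length es) (length es)"
  "fun_mat f ws vs \<in> carrier_mat (length ws) (length vs)"
  "walk_mat vs es \<in> carrier_mat (length es) (length vs)"
  by (simp_all add: inc_mat_def gram_tri_def fun_mat_def walk_mat_def)

lemma gram_tri_unitriangular: "upper_triangular (gram_tri es)" "det (gram_tri es) = 1"
proof -
  show "upper_triangular (gram_tri es)"
    by (auto simp: gram_tri_def intro!: upper_triangularI)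
  then show "det (gram_tri es) = 1"
    by (intro det_unitriangular[of _ "length es"]) (auto simp: gram_tri_def)
qed

lemma sum_distinct_list:
  assumes "distinct vs"
  shows "(\<Sum>k<length vs. f (vs ! k)) = sum f (set vs)"
  using sum.reindex_bij_betw[OF bij_betw_nth[OF assms refl refl], of f] by simp

lemma edge_dot_commute: "edge_dot e f = edge_dot f e"
  by (auto simp: edge_dot_def edge_vec_def)

lemma inc_mat_gram:
  assumes vs: "distinct vs" and es: "edges_on (set vs) es"
  shows "(inc_mat vs es)\<^sup>T * inc_mat vs es = gram_tri es + (gram_tri es)\<^sup>T"
proof (rule eq_matI)
  fix i j
  assume "i < dim_row (gram_tri es + (gram_tri es)\<^sup>T)" "j < dim_col (gram_tri es + (gram_tri es)\<^sup>T)"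
  then have ij: "i < length es" "j < length es"
    by (auto simp: gram_tri_def)
  have "((inc_mat vs es)\<^sup>T * inc_mat vs es) $$ (i, j) =
      (\<Sum>k<length vs. edge_vec (es ! i) (vs ! k) * edge_vec (es ! j) (vs ! k))"
    using ij by (simp add: inc_mat_def scalar_prod_def atLeast0LessThan)
  also have "\<dots> = (\<Sum>v\<in>set vs. edge_vec (es ! i) v * edge_vec (es ! j) v)"
    by (rule sum_distinct_list[OF vs])
  also have "\<dots> = edge_dot (es ! i) (es ! j)"
    using edges_on_nth[OF es ij(2)] by (simp add: sum_edge_vec edge_dot_def)
  also have "\<dots> = (gram_tri es + (gram_tri es)\<^sup>T) $$ (i, j)"
    using ij edges_on_nth(3)[OF es ij(1)] edge_dot_commute[of "es ! i" "es ! j"]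
    by (auto simp: gram_tri_def edge_dot_self)
  finally show "((inc_mat vs es)\<^sup>T * inc_mat vs es) $$ (i, j) = (gram_tri es + (gram_tri es)\<^sup>T) $$ (i, j)" .
qed (auto simp: gram_tri_def inc_mat_def)

text \<open>
  By \<open>reflection_edge\<close> the terms above the diagonal are differences of consecutive values.
  Together with the diagonal term they telescope to the value at the end of the list, where
  no reflection is left.
\<close>

lemma gram_tri_walk_mat:
  assumes es: "edges_on (set vs) es"
  shows "gram_tri es * walk_mat vs es = (inc_mat vs es)\<^sup>T"
proof (rule eq_matI)
  fix i k
  assume "i < dim_row ((inc_mat vs es)\<^sup>T)" "k < dim_col ((inc_mat vs es)\<^sup>T)"
  then have i: "i < length es" and k: "k < length vs"
    by (auto simp: inc_mat_def)
  let ?n = "length es" and ?e = "es ! i"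
  let ?x = "\<lambda>j. swaps (drop j es) (vs ! k)"
  have "(gram_tri es * walk_mat vs es) $$ (i, k) =
      (\<Sum>j<?n. (if i = j then 1 else if i < j then edge_dot ?e (es ! j) else 0) * edge_vec (es ! j) (?x (Suc j)))"
    using i k by (simp add: gram_tri_def walk_mat_def scalar_prod_def atLeast0LessThan)
  also have "\<dots> = (\<Sum>j\<in>{i..<?n}. (if i = j then 1 else if i < j then edge_dot ?e (es ! j) else 0) * edge_vec (es ! j) (?x (Suc j)))"
    by (intro sum.mono_neutral_right) auto
  also have "\<dots> = edge_vec ?e (?x (Suc i)) + (\<Sum>j\<in>{Suc i..<?n}. edge_dot ?e (es ! j) * edge_vec (es ! j) (?x (Suc j)))"
    using i by (simp add: sum.atLeast_Suc_lessThan)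
  also have "(\<Sum>j\<in>{Suc i..<?n}. edge_dot ?e (es ! j) * edge_vec (es ! j) (?x (Suc j)))
      = (\<Sum>j\<in>{Suc i..<?n}. edge_vec ?e (?x (Suc j)) - edge_vec ?e (?x j))"
    using edges_on_nth(3)[OF es] by (intro sum.cong) (simp_all add: swaps_drop reflection_edge)
  also have "\<dots> = edge_vec ?e (?x ?n) - edge_vec ?e (?x (Suc i))"
    using i by (intro sum_Suc_diff') simp
  finally show "(gram_tri es * walk_mat vs es) $$ (i, k) = (inc_mat vs es)\<^sup>T $$ (i, k)"
    using i k by (simp add: inc_mat_def)
qed (auto simp: gram_tri_def inc_mat_def walk_mat_def)

text \<open>
  By \<open>reflection_point\<close> the sum telescopes from the identity to the product of all
  transpositions.
\<close>

lemma inc_mat_walk_mat: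
  assumes vs: "distinct vs" and es: "edges_on (set vs) es"
  shows "inc_mat vs es * walk_mat vs es = 1\<^sub>m (length vs) - fun_mat (swaps es) vs vs"
proof (rule eq_matI)
  fix k l
  assume "k < dim_row (1\<^sub>m (length vs) - fun_mat (swaps es) vs vs)"
    "l < dim_col (1\<^sub>m (length vs) - fun_mat (swaps es) vs vs)"
  then have kl: "k < length vs" "l < length vs"
    by (auto simp: fun_mat_def)
  let ?n = "length es"
  let ?x = "\<lambda>j. swaps (drop j es) (vs ! l)"
  have "(inc_mat vs es * walk_mat vs es) $$ (k, l) =
      (\<Sum>j<?n. edge_vec (es ! j) (vs ! k) * edge_vec (es ! j) (?x (Suc j)))"
    using kl by (simp add: inc_mat_def walk_mat_def scalar_prod_def atLeast0LessThan)
  also have "\<dots> = (\<Sum>j<?n. of_bool (vs ! k = ?x (Suc j)) - of_bool (vs ! k = ?x j))"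
    using edges_on_nth(3)[OF es] by (intro sum.cong) (simp_all add: swaps_drop reflection_point)
  also have "\<dots> = of_bool (vs ! k = ?x ?n) - of_bool (vs ! k = ?x 0)"
    by (rule sum_lessThan_telescope)
  finally show "(inc_mat vs es * walk_mat vs es) $$ (k, l) = (1\<^sub>m (length vs) - fun_mat (swaps es) vs vs) $$ (k, l)"
    using kl vs by (simp add: fun_mat_def nth_eq_iff_index_eq)
qed (auto simp: fun_mat_def inc_mat_def walk_mat_def)

text \<open>
  With \<open>W = U\<^sup>-\<^sup>1\<close>, the Coxeter matrix is \<open>1 - A\<^sup>T (A W)\<close>, because \<open>U\<^sup>T = A\<^sup>T A - U\<close>. After the exchange of
  the two factors one has \<open>1 - A (W A\<^sup>T)\<close>, which the telescoping sums identify as a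
  permutation matrix.
\<close>

lemma char_poly_coxeter_gram_tri:
  assumes vs: "distinct vs" and es: "edges_on (set vs) es"
  defines "U \<equiv> gram_tri es"
  shows "[:-1, 1:] ^ length vs * char_poly (- (U\<^sup>T * mat_inv U)) =
    [:-1, 1:] ^ length es * char_poly (fun_mat (swaps es) vs vs)"
proof -
  let ?n = "length es" and ?m = "length vs"
  define A where "A = inc_mat vs es"
  define W where "W = mat_inv U"
  have U: "U \<in> carrier_mat ?n ?n" and A: "A \<in> carrier_mat ?m ?n"
    by (simp_all add: U_def A_def)
  have W: "W \<in> carrier_mat ?n ?n" "U * W = 1\<^sub>m ?n" "W * U = 1\<^sub>m ?n"
    using mat_inv_unimodular[OF U] gram_tri_unitriangular(2)[of es] by (auto simp: U_def W_def)
  have Y: "walk_mat vs es \<in> carrier_mat ?n ?m" by simp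
  have "W * A\<^sup>T = W * (U * walk_mat vs es)"
    using gram_tri_walk_mat[OF es] by (simp add: U_def A_def)
  also have "\<dots> = W * U * walk_mat vs es"
    by (rule assoc_mult_mat[OF W(1) U Y, symmetric])
  also have "\<dots> = walk_mat vs es"
    unfolding W(3) by (rule left_mult_one_mat[OF Y])
  finally have WA: "W * A\<^sup>T = walk_mat vs es" .
  have "A * W * A\<^sup>T = A * (W * A\<^sup>T)"
    using A by (intro assoc_mult_mat[OF A W(1), of _ ?m]) simp
  then have "A * W * A\<^sup>T = 1\<^sub>m ?m - fun_mat (swaps es) vs vs"
    unfolding WA using inc_mat_walk_mat[OF vs es] by (simp add: A_def)
  then have P: "1\<^sub>m ?m - (A * W) * A\<^sup>T = fun_mat (swaps es) vs vs"
    by (auto intro!: eq_matI simp: fun_mat_def)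
  have UT: "U\<^sup>T = A\<^sup>T * A - U"
    unfolding A_def inc_mat_gram[OF vs es] U_def[symmetric] using U by (intro eq_matI) auto
  have "- (U\<^sup>T * W) = - (A\<^sup>T * A * W - U * W)"
    using A U W by (simp add: UT minus_mult_distrib_mat[of _ ?n ?n _ _ ?n])
  also have "\<dots> = 1\<^sub>m ?n - A\<^sup>T * (A * W)"
    using A U W by (auto intro!: eq_matI simp: assoc_mult_mat[of _ ?n ?m _ ?n _ ?n])
  finally have Phi: "- (U\<^sup>T * W) = 1\<^sub>m ?n - A\<^sup>T * (A * W)" .
  show ?thesis
    using char_poly_one_minus_swap[of "A\<^sup>T" ?n ?m "A * W"] A W P Phi by (simp add: W_def)
qed

section \<open>Characteristic polynomials of permutation matrices\<close>

lemma fun_mat_mult: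
  assumes ws: "distinct ws" and g: "\<And>v. v \<in> set vs \<Longrightarrow> g v \<in> set ws"
  shows "fun_mat f us ws * fun_mat g ws vs = fun_mat (f \<circ> g) us vs"
proof (rule eq_matI)
  fix k l
  assume "k < dim_row (fun_mat (f \<circ> g) us vs)" "l < dim_col (fun_mat (f \<circ> g) us vs)"
  then have kl: "k < length us" "l < length vs"
    by (auto simp: fun_mat_def)
  have "(fun_mat f us ws * fun_mat g ws vs) $$ (k, l) =
      (\<Sum>j<length ws. of_bool (us ! k = f (ws ! j)) * of_bool (ws ! j = g (vs ! l)))"
    using kl by (simp add: fun_mat_def scalar_prod_def atLeast0LessThan)
  also have "\<dots> = (\<Sum>w\<in>set ws. of_bool (us ! k = f w) * of_bool (w = g (vs ! l)))"
    by (rule sum_distinct_list[OF ws])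
  also have "\<dots> = (\<Sum>w\<in>set ws. if w = g (vs ! l) then of_bool (us ! k = f w) else 0)"
    by (intro sum.cong) auto
  also have "\<dots> = of_bool (us ! k = f (g (vs ! l)))"
    using g[of "vs ! l"] kl by simp
  finally show "(fun_mat f us ws * fun_mat g ws vs) $$ (k, l) = fun_mat (f \<circ> g) us vs $$ (k, l)"
    using kl by (simp add: fun_mat_def)
qed (auto simp: fun_mat_def)

lemma fun_mat_id: "distinct vs \<Longrightarrow> fun_mat id vs vs = 1\<^sub>m (length vs)"
  by (auto intro!: eq_matI simp: fun_mat_def nth_eq_iff_index_eq)

lemma char_poly_fun_mat_reorder:
  assumes "distinct vs" "distinct ws" "set vs = set ws" and p: "\<And>v. v \<in> set vs \<Longrightarrow> p v \<in> set vs"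
  shows "char_poly (fun_mat p vs vs) = char_poly (fun_mat p ws ws)"
proof -
  have len: "length vs = length ws"
    using assms(1-3) by (metis distinct_card)
  have "similar_mat (fun_mat p vs vs) (fun_mat p ws ws)"
  proof (rule similar_matI)
    show "{fun_mat p vs vs, fun_mat p ws ws, fun_mat id vs ws, fun_mat id ws vs} \<subseteq> carrier_mat (length vs) (length vs)"
      using len carrier_graph_mats(3)[of p vs vs] carrier_graph_mats(3)[of p ws ws] carrier_graph_mats(3)[of id vs ws]
        carrier_graph_mats(3)[of id ws vs] by auto
    show "fun_mat id vs ws * fun_mat id ws vs = 1\<^sub>m (length vs)"
      "fun_mat id ws vs * fun_mat id vs ws = 1\<^sub>m (length vs)"
      using assms(1-3) len fun_mat_mult[where ws = ws and vs = vs and g = id and us = vs and f = id]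
        fun_mat_mult[where ws = vs and vs = ws and g = id and us = ws and f = id]
      by (simp_all add: fun_mat_id)
    show "fun_mat p vs vs = fun_mat id vs ws * fun_mat p ws ws * fun_mat id ws vs"
      using assms fun_mat_mult[where ws = ws and vs = ws and g = p and us = vs and f = id]
        fun_mat_mult[where ws = ws and vs = vs and g = id and us = vs and f = p] by simp
  qed
  then show ?thesis
    by (rule char_poly_similar)
qed

text \<open>
  As both lists are closed under \<open>p\<close>, the matrix is block diagonal.
\<close>

lemma char_poly_fun_mat_append:
  assumes disj: "set xs \<inter> set ys = {}"
    and xs: "\<And>v. v \<in> set xs \<Longrightarrow> p v \<in> set xs" and ys: "\<And>v. v \<in> set ys \<Longrightarrow> p v \<in> set ys"
  shows "char_poly (fun_mat p (xs @ ys) (xs @ ys)) = char_poly (fun_mat p xs xs) * char_poly (fun_mat p ys ys)"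
proof -
  let ?a = "length xs" and ?b = "length ys"
  have "char_poly_matrix (fun_mat p (xs @ ys) (xs @ ys)) =
      four_block_mat (char_poly_matrix (fun_mat p xs xs)) (0\<^sub>m ?a ?b) (0\<^sub>m ?b ?a) (char_poly_matrix (fun_mat p ys ys))"
    (is "_ = ?R")
  proof (rule eq_matI)
    fix i j assume "i < dim_row ?R" "j < dim_col ?R"
    then have ij: "i < ?a + ?b" "j < ?a + ?b"
      by (auto simp: char_poly_matrix_def fun_mat_def)
    have "(xs @ ys) ! i \<noteq> p ((xs @ ys) ! j)" if "(i < ?a) \<noteq> (j < ?a)"
    proof (cases "i < ?a")
      case True
      then have "\<not> j < ?a" using that by simp
      then have "p (ys ! (j - ?a)) \<in> set ys" "xs ! i \<in> set xs"
        using True ij by (auto intro!: ys)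
      then show ?thesis
        using True \<open>\<not> j < ?a\<close> disj by (simp add: nth_append) (metis disjoint_iff nth_mem)
    next
      case False
      then have "j < ?a" using that by simp
      then have "p (xs ! j) \<in> set xs" "ys ! (i - ?a) \<in> set ys"
        using False ij by (auto intro!: xs)
      then show ?thesis
        using False \<open>j < ?a\<close> disj by (auto simp: nth_append)
    qed
    then show "char_poly_matrix (fun_mat p (xs @ ys) (xs @ ys)) $$ (i, j) = ?R $$ (i, j)"
      using ij by (auto simp: char_poly_matrix_def fun_mat_def nth_append)
  qed (auto simp: char_poly_matrix_def fun_mat_def)
  then show ?thesis
    unfolding char_poly_def
    by (simp add: det_four_block_mat_lower_left_zero[of _ ?a _ ?b])
qed

text \<open>
  In the first row of the characteristic matrix only the first and the last entry are nonzero, and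
  both minors are triangular.
\<close>

lemma char_poly_fun_mat_cycle:
  assumes vs: "distinct vs" "vs \<noteq> []"
    and p: "\<And>i. i < length vs \<Longrightarrow> p (vs ! i) = vs ! (Suc i mod length vs)"
  shows "char_poly (fun_mat p vs vs) = monom 1 (length vs) - 1"
proof -
  let ?k = "length vs"
  define M where "M = char_poly_matrix (fun_mat p vs vs)"
  have M: "M \<in> carrier_mat ?k ?k"
    by (simp add: M_def)
  have entry: "M $$ (i, j) = (if i = j then [:0, 1:] else 0) - (if i = Suc j mod ?k then 1 else 0)"
    if "i < ?k" "j < ?k" for i j
    using that vs by (auto simp: M_def char_poly_matrix_def fun_mat_def p nth_eq_iff_index_eq pCons_one)
  have x: "[:0, 1:] = (monom 1 1 :: int poly)"
    by (simp add: monom_Suc monom_0)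
  show ?thesis
  proof (cases "?k = 1")
    case True
    then have "det M = M $$ (0, 0)"
      using M by (intro det_single) simp
    then show ?thesis
      using True by (simp add: char_poly_def M_def[symmetric] entry x)
  next
    case False
    then obtain k where k: "?k = Suc (Suc k)"
      using vs(2) by (metis One_nat_def length_0_conv not0_implies_Suc)
    \<comment> \<open>The minors of the two nonzero entries of the first row.\<close>
    define D where "D = mat_delete M 0 0"
    define E where "E = mat_delete M 0 (Suc k)"
    have D: "D \<in> carrier_mat (Suc k) (Suc k)" and E: "E \<in> carrier_mat (Suc k) (Suc k)"
      using M k by (auto simp: D_def E_def mat_delete_def)
    have De: "D $$ (i, j) = (if i = j then [:0, 1:] else 0) - (if Suc i = Suc (Suc j) mod ?k then 1 else 0)"
      if "i < Suc k" "j < Suc k" for i j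
      using that k M by (simp add: D_def mat_delete_def entry)
    have Ee: "E $$ (i, j) = (if Suc i = j then [:0, 1:] else 0) - (if i = j then 1 else 0)"
      if "i < Suc k" "j < Suc k" for i j
      using that k M by (simp add: E_def mat_delete_def entry)
    have "det D = prod_list (diag_mat D)"
      by (rule det_lower_triangular[OF _ D]) (auto simp: De k mod_Suc)
    also have "diag_mat D = replicate (Suc k) [:0, 1:]"
      using D by (intro nth_equalityI) (auto simp: diag_mat_def De k mod_Suc simp del: upt_Suc replicate_Suc)
    finally have detD: "det D = [:0, 1:] ^ Suc k"
      by simp
    have "det E = prod_list (diag_mat E)"
      by (rule det_upper_triangular[OF _ E]) (use E in \<open>auto simp: Ee\<close>)
    also have "diag_mat E = replicate (Suc k) (-1)"
      using E by (intro nth_equalityI) (auto simp: diag_mat_def Ee simp del: upt_Suc replicate_Suc)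
    finally have detE: "det E = (-1) ^ Suc k"
      by simp
    have "det M = (\<Sum>j<?k. M $$ (0, j) * cofactor M 0 j)"
      using M k by (intro laplace_expansion_row) auto
    also have "\<dots> = (\<Sum>j\<in>{0, Suc k}. M $$ (0, j) * cofactor M 0 j)"
      using k by (intro sum.mono_neutral_right) (auto simp: entry mod_Suc split: if_splits)
    also have "\<dots> = [:0, 1:] * det D - (-1) ^ Suc k * det E"
      by (simp add: entry k cofactor_def D_def E_def)
    also have "\<dots> = monom 1 ?k - 1"
      by (simp add: detD detE k x monom_power mult_monom flip: power_mult_distrib)
    finally show ?thesis
      by (simp add: char_poly_def M_def)
  qed
qed

text \<open>
  Listing the orbit of one element first, in cyclic order, splits off one factor.
\<close>

lemma char_poly_fun_mat_permutes:
  assumes V: "finite V" and p: "p permutes V" and vs: "distinct vs" "set vs \<subseteq> V"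
    and closed: "\<And>v. v \<in> set vs \<Longrightarrow> p v \<in> set vs"
  shows "char_poly (fun_mat p vs vs) = (\<Prod>C\<in>orbit p ` set vs. monom 1 (card C) - 1)"
  using vs closed
proof (induction "length vs" arbitrary: vs rule: less_induct)
  case less
  have perm: "permutation p"
    using V p by (auto simp: permutation_permutes)
  show ?case
  proof (cases "vs = []")
    case True
    then show ?thesis
      by (simp add: char_poly_def det_dim_zero[of "char_poly_matrix (fun_mat p [] [])"] char_poly_matrix_def fun_mat_def)
  next
    case False
    then obtain s where s: "s \<in> set vs"
      by (meson hd_in_set)
    define k where "k = funpow_dist1 p s s"
    define xs where "xs = map (\<lambda>i. (p ^^ i) s) [0..<k]"
    define ys where "ys = filter (\<lambda>v. v \<notin> orbit p s) vs"
    have self: "s \<in> orbit p s"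
      using perm by (rule permutation_self_in_orbit)
    have xs: "set xs = orbit p s" "distinct xs" "xs \<noteq> []"
      using orbit_conv_funpow_dist1[OF self, folded k_def] inj_on_funpow_dist1[OF self, folded k_def]
        orbit_nonempty[of p s] by (auto simp: xs_def distinct_map)
    have sub: "orbit p s \<subseteq> set vs"
    proof
      fix t assume "t \<in> orbit p s"
      then show "t \<in> set vs"
        by induction (use s less.prems(3) in auto)
    qed
    have ys: "distinct ys" "set ys = set vs - orbit p s"
      using less.prems(1) by (auto simp: ys_def)
    have ys_closed: "p v \<in> set ys" if v: "v \<in> set ys" for v
    proof -
      have "p v \<notin> orbit p s"
      proof
        assume "p v \<in> orbit p s"
        then have "orbit p (p v) = orbit p s"
          using cyclic_on_orbit'[OF perm, of s] orbit_cyclic_eq3 by metis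
        then have "v \<in> orbit p s"
          using permutation_orbit_step[OF perm, of v] permutation_self_in_orbit[OF perm, of v] by simp
        then show False
          using v ys(2) by auto
      qed
      then show ?thesis
        using v ys(2) less.prems(3) by auto
    qed
    have cyc: "p (xs ! i) = xs ! (Suc i mod length xs)" if "i < length xs" for i
    proof (cases "Suc i = length xs")
      case True
      then show ?thesis
        using funpow_dist1_prop[OF self, folded k_def] that
        by (simp add: xs_def flip: funpow.simps(2) o_apply[of p])
    next
      case False
      then have "Suc i < k"
        using that by (simp add: xs_def)
      then show ?thesis
        by (simp add: xs_def)
    qed
    have len: "length ys < length vs"
      using s self unfolding ys_def by (intro length_filter_less) auto
    have "char_poly (fun_mat p vs vs) = char_poly (fun_mat p (xs @ ys) (xs @ ys))"
      using less.prems xs ys sub by (intro char_poly_fun_mat_reorder) auto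
    also have "\<dots> = char_poly (fun_mat p xs xs) * char_poly (fun_mat p ys ys)"
      using xs ys ys_closed by (intro char_poly_fun_mat_append) (auto intro: orbit.step)
    also have "char_poly (fun_mat p xs xs) = monom 1 (length xs) - 1"
      using xs cyc by (intro char_poly_fun_mat_cycle) auto
    also have "length xs = card (orbit p s)"
      using xs distinct_card by metis
    also have "char_poly (fun_mat p ys ys) = (\<Prod>C\<in>orbit p ` set ys. monom 1 (card C) - 1)"
      using less.hyps[OF len ys(1)] ys less.prems(2) ys_closed by blast
    also have "(monom 1 (card (orbit p s)) - 1) * \<dots> = (\<Prod>C\<in>insert (orbit p s) (orbit p ` set ys). monom 1 (card C) - 1)"
    proof -
      have "orbit p s \<notin> orbit p ` set ys"
        using ys(2) permutation_self_in_orbit[OF perm] by auto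
      then show ?thesis by simp
    qed
    also have "insert (orbit p s) (orbit p ` set ys) = orbit p ` set vs"
    proof -
      have "orbit p t = orbit p s" if "t \<in> orbit p s" for t
        using cyclic_on_orbit'[OF perm, of s] that by (rule orbit_cyclic_eq3)
      then show ?thesis
        using s unfolding ys(2) by auto
    qed
    finally show ?thesis .
  qed
qed

section \<open>Connected quivers and the permutation of their vertices\<close>

text \<open>
  Connectedness enters all arguments through functions that are constant along the arrows. This
  lemma and the next one translate between such functions and reachability.
\<close>

lemma connected_imp_constant:
  assumes Q: "wf_digraph Q" "Digraph_Component.connected Q"
    and f: "\<And>a. a \<in> arcs Q \<Longrightarrow> f (tail Q a) = f (head Q a)"
    and uv: "u \<in> verts Q" "v \<in> verts Q"
  shows "f u = f v"
proof -
  interpret wf_digraph Q by fact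
  have "u \<rightarrow>\<^sup>*\<^bsub>with_proj (mk_symmetric Q)\<^esub> v"
    using Q(2) uv by (auto simp: Digraph_Component.connected_def strongly_connected_def)
  then have "(u, v) \<in> rtrancl_on (verts Q) (parcs (mk_symmetric Q))"
    by (simp add: reachable_def)
  then show ?thesis
    by (induction rule: rtrancl_on_induct) (use f in \<open>auto simp: parcs_mk_symmetric\<close>)
qed

lemma connectedI_constant:
  assumes Q: "wf_digraph Q" "verts Q \<noteq> {}"
    and const: "\<And>f :: 'v \<Rightarrow> bool. (\<And>a. a \<in> arcs Q \<Longrightarrow> f (tail Q a) = f (head Q a)) \<Longrightarrow>
      (\<And>u v. u \<in> verts Q \<Longrightarrow> v \<in> verts Q \<Longrightarrow> f u = f v)"
  shows "Digraph_Component.connected (Q :: ('v, 'a) pre_digraph)"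
proof -
  interpret wf_digraph Q by fact
  have "(u, v) \<in> rtrancl_on (verts Q) (parcs (mk_symmetric Q))" if uv: "u \<in> verts Q" "v \<in> verts Q" for u v
  proof -
    let ?f = "\<lambda>w. (u, w) \<in> rtrancl_on (verts Q) (parcs (mk_symmetric Q))"
    have "?f (tail Q a) = ?f (head Q a)" if a: "a \<in> arcs Q" for a
    proof -
      have "(tail Q a, head Q a) \<in> parcs (mk_symmetric Q)" "(head Q a, tail Q a) \<in> parcs (mk_symmetric Q)"
        using a by (auto simp: parcs_mk_symmetric)
      then show ?thesis
        using a by (meson rtrancl_on_into_rtrancl_on head_in_verts tail_in_verts)
    qed
    then have "?f u = ?f v"
      using uv by (rule const)
    then show ?thesis
      using uv by simp
  qed
  then show ?thesis
    using Q(2) by (auto simp: Digraph_Component.connected_def strongly_connected_def reachable_def)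
qed

definition vertex_list :: "('v :: linorder, 'a :: linorder) pre_digraph \<Rightarrow> 'v list" where
  "vertex_list Q = sorted_list_of_set (verts Q)"

definition arrow_list :: "('v :: linorder, 'a :: linorder) pre_digraph \<Rightarrow> ('v \<times> 'v) list" where
  "arrow_list Q = map (\<lambda>a. (tail Q a, head Q a)) (sorted_list_of_set (arcs Q))"

lemma conn_loopless_quiverD:
  assumes "conn_loopless_quiver Q"
  shows "finite (verts Q)" "finite (arcs Q)" "wf_digraph Q" "Digraph_Component.connected Q"
    "\<And>a. a \<in> arcs Q \<Longrightarrow> tail Q a \<in> verts Q" "\<And>a. a \<in> arcs Q \<Longrightarrow> head Q a \<in> verts Q"
    "\<And>a. a \<in> arcs Q \<Longrightarrow> tail Q a \<noteq> head Q a"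
proof -
  interpret fin_digraph Q using assms by (simp add: conn_loopless_quiver_def)
  interpret loopfree_digraph Q using assms by (simp add: conn_loopless_quiver_def)
  show "finite (verts Q)" "finite (arcs Q)" "wf_digraph Q" "Digraph_Component.connected Q"
    "\<And>a. a \<in> arcs Q \<Longrightarrow> tail Q a \<in> verts Q" "\<And>a. a \<in> arcs Q \<Longrightarrow> head Q a \<in> verts Q"
    "\<And>a. a \<in> arcs Q \<Longrightarrow> tail Q a \<noteq> head Q a"
    using assms no_loops by (auto simp: conn_loopless_quiver_def wf_digraph_axioms)
qed

lemma vertex_list:
  assumes "conn_loopless_quiver Q"
  shows "distinct (vertex_list Q)" "set (vertex_list Q) = verts Q" "length (vertex_list Q) = card (verts Q)"
  using conn_loopless_quiverD[OF assms] by (auto simp: vertex_list_def)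

lemma arrow_list:
  assumes "conn_loopless_quiver Q"
  shows "edges_on (verts Q) (arrow_list Q)" "length (arrow_list Q) = card (arcs Q)"
  using conn_loopless_quiverD[OF assms] by (auto simp: arrow_list_def edges_on_def)

lemma incidence_mat_eq:
  assumes "conn_loopless_quiver Q"
  shows "incidence_mat Q = inc_mat (vertex_list Q) (arrow_list Q)"
  using vertex_list[OF assms] arrow_list[OF assms] conn_loopless_quiverD[OF assms]
  by (auto intro!: eq_matI simp: incidence_mat_def inc_mat_def Let_def edge_vec_def vertex_list_def arrow_list_def)

lemma quiver_form_eq:
  assumes Q: "conn_loopless_quiver Q" and x: "x \<in> carrier_vec (card (arcs Q))"
  shows "quiver_form Q x = x \<bullet> (gram_tri (arrow_list Q) *\<^sub>v x)"
proof -
  define A where "A = inc_mat (vertex_list Q) (arrow_list Q)"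
  define U where "U = gram_tri (arrow_list Q)"
  let ?n = "card (arcs Q)"
  have A: "A \<in> carrier_mat (card (verts Q)) ?n" and U: "U \<in> carrier_mat ?n ?n"
    unfolding A_def U_def using vertex_list[OF Q] arrow_list[OF Q]
    by (metis carrier_graph_mats(1), metis carrier_graph_mats(2))
  have "(A *\<^sub>v x) \<bullet> (A *\<^sub>v x) = x \<bullet> ((A\<^sup>T * A) *\<^sub>v x)"
    by (rule scalar_prod_gram[OF A x, symmetric])
  also have "A\<^sup>T * A = U + U\<^sup>T"
    unfolding A_def U_def using vertex_list[OF Q] arrow_list[OF Q] by (intro inc_mat_gram) auto
  also have "x \<bullet> ((U + U\<^sup>T) *\<^sub>v x) = x \<bullet> (U *\<^sub>v x) + x \<bullet> (U\<^sup>T *\<^sub>v x)"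
    using U x by (simp add: add_mult_distrib_mat_vec[of _ ?n ?n] scalar_prod_add_distrib[of _ ?n])
  also have "x \<bullet> (U\<^sup>T *\<^sub>v x) = x \<bullet> (U *\<^sub>v x)"
    using U x transpose_vec_mult_scalar[OF U x x] by (simp add: comm_scalar_prod[of _ ?n])
  finally show ?thesis
    using x by (simp add: quiver_form_def incidence_mat_eq[OF Q] flip: A_def U_def)
qed

lemma tri_gram_quiver_form:
  assumes Q: "conn_loopless_quiver Q"
  shows "tri_gram (card (arcs Q)) (quiver_form Q) = gram_tri (arrow_list Q)"
  using quiver_form_eq[OF Q] gram_tri_unitriangular(1)[of "arrow_list Q"]
    carrier_graph_mats(2)[of "arrow_list Q"] arrow_list(2)[OF Q]
  by (intro tri_gram_unique) auto

lemma swaps_eq_self: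
  assumes "\<And>e. e \<in> set es \<Longrightarrow> fst e \<noteq> v \<and> snd e \<noteq> v"
  shows "swaps es v = v"
  using assms
proof (induction es)
  case (Cons e es)
  then have "swaps es v = v" "fst e \<noteq> v" "snd e \<noteq> v"
    by auto
  then show ?case
    by (simp add: transpose_apply_other)
qed simp

lemma transpose_other_end:
  assumes "tail Q a = v \<or> head Q a = v"
  shows "Transposition.transpose (tail Q a) (head Q a) v = other_end Q a v"
  using assms by (auto simp: other_end_def)

text \<open>
  If the largest arrow below \<open>i\<close> is not incident to \<open>v\<close>, then its transposition fixes \<open>v\<close> and the walk
  does not see it. Otherwise both the transposition and the walk lead to its other end. The
  walk is extended by its preceding step to cover the case in which it stops at once.
\<close>

lemma swaps_arrow_prefix:
  assumes fin: "finite (arcs Q)" and k: "k \<le> length (sorted_list_of_set (arcs Q))"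
    and below: "{j \<in> arcs Q. j < i} = set (take k (sorted_list_of_set (arcs Q)))"
  shows "swaps (take k (arrow_list Q)) v = snd (last ((i, v) # descend Q i v))"
  using k below
proof (induction k arbitrary: i v)
  case 0
  then have "{j \<in> incident_arrows Q v. j < i} = {}"
    by (auto simp: incident_arrows_def)
  then show ?case
    by (simp add: descend.simps[of Q i v])
next
  case (Suc k)
  let ?as = "sorted_list_of_set (arcs Q)"
  let ?a = "?as ! k"
  have k: "k < length ?as" using Suc.prems(1) by simp
  have a: "?a \<in> arcs Q" using k fin by (metis nth_mem set_sorted_list_of_set)
  have srt: "?as ! j < ?as ! l" if "j < l" "l < length ?as" for j l
    using strict_sorted_list_of_set[of "arcs Q"] that by (simp add: sorted_wrt_iff_nth_less)
  have below_a: "{j \<in> arcs Q. j < ?a} = set (take k ?as)"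
  proof (intro equalityI subsetI)
    fix j assume "j \<in> {j \<in> arcs Q. j < ?a}"
    then have "j \<in> set ?as" "j < ?a"
      using fin by auto
    then obtain l where l: "l < length ?as" "j = ?as ! l" "?as ! l < ?a"
      by (auto simp: in_set_conv_nth)
    then have "l < k"
      using srt[of k l] by (metis linorder_neqE_nat order.asym order.irrefl)
    then show "j \<in> set (take k ?as)"
      using l k by (auto simp: in_set_conv_nth intro!: exI[of _ l])
  next
    fix j assume "j \<in> set (take k ?as)"
    then obtain l where l: "l < k" "j = ?as ! l"
      using k by (auto simp: in_set_conv_nth)
    then have "j \<in> set ?as" "j < ?a"
      using srt[of l k] k by auto
    then show "j \<in> {j \<in> arcs Q. j < ?a}"
      using fin by simp
  qed
  have below_i: "{j \<in> arcs Q. j < i} = insert ?a {j \<in> arcs Q. j < ?a}"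
    using Suc.prems(2) k by (simp add: below_a take_Suc_conv_app_nth)
  have less_i: "j < i \<longleftrightarrow> j = ?a \<or> j < ?a" if "j \<in> arcs Q" for j
    using below_i that by blast
  have sw: "swaps (take (Suc k) (arrow_list Q)) v =
      swaps (take k (arrow_list Q)) (Transposition.transpose (tail Q ?a) (head Q ?a) v)"
    using k by (simp add: arrow_list_def take_Suc_conv_app_nth swaps_append)
  note IH = Suc.IH[OF less_imp_le[OF k] below_a]
  show ?case
  proof (cases "?a \<in> incident_arrows Q v")
    case True
    have "Max {j \<in> incident_arrows Q v. j < i} = ?a"
      using True less_i[OF a] fin by (intro Max_eqI) (auto simp: incident_arrows_def less_i)
    moreover have "?a \<in> {j \<in> incident_arrows Q v. j < i}"
      using True less_i[OF a] by simp
    moreover have "{j \<in> incident_arrows Q v. j < i} \<noteq> {}"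
      using calculation(2) by blast
    ultimately have D: "descend Q i v = (?a, other_end Q ?a v) # descend Q ?a (other_end Q ?a v)"
      using fin by (subst descend.simps) (simp only: Let_def, simp)
    have t: "Transposition.transpose (tail Q ?a) (head Q ?a) v = other_end Q ?a v"
      using True by (intro transpose_other_end) (simp add: incident_arrows_def)
    show ?thesis
      unfolding sw t IH D by simp
  next
    case False
    then have "{j \<in> incident_arrows Q v. j < i} = {j \<in> incident_arrows Q v. j < ?a}"
      using less_i by (auto simp: incident_arrows_def)
    then have D: "descend Q i v = descend Q ?a v"
      unfolding descend.simps[of Q i v] descend.simps[of Q ?a v] by (simp only:)
    have t: "Transposition.transpose (tail Q ?a) (head Q ?a) v = v"
      using False a by (auto simp: incident_arrows_def)
    show ?thesis
      unfolding sw t IH D by (cases "descend Q ?a v") simp_all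
  qed
qed

text \<open>
  The arrows above the largest arrow incident to \<open>v\<close> do not move \<open>v\<close>, and that arrow itself is the first
  step of the walk.
\<close>

lemma xi_eq_swaps:
  assumes fin: "finite (arcs Q)" and v: "incident_arrows Q v \<noteq> {}"
  shows "xi Q v = swaps (arrow_list Q) v"
proof -
  let ?as = "sorted_list_of_set (arcs Q)"
  define a where "a = Max (incident_arrows Q v)"
  have finv: "finite (incident_arrows Q v)"
    using fin by (simp add: incident_arrows_def)
  have a: "a \<in> incident_arrows Q v"
    unfolding a_def using finv v by (rule Max_in)
  then have "a \<in> set ?as" using fin by (simp add: incident_arrows_def)
  then obtain xs ys where split: "?as = xs @ a # ys"
    by (meson split_list)
  have "sorted_wrt (<) (xs @ a # ys)"
    unfolding split[symmetric] by (rule strict_sorted_list_of_set)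
  then have xs: "\<And>j. j \<in> set xs \<Longrightarrow> j < a" and ys: "\<And>j. j \<in> set ys \<Longrightarrow> a < j"
    by (auto simp: sorted_wrt_append)
  let ?e = "\<lambda>a. (tail Q a, head Q a)"
  have "swaps (map ?e ys) v = v"
  proof (rule swaps_eq_self)
    fix e assume "e \<in> set (map ?e ys)"
    then obtain j where j: "j \<in> set ys" "e = ?e j" by auto
    then have "j \<in> arcs Q"
      using split fin by (metis Un_iff list.set_intros(2) set_append set_sorted_list_of_set)
    moreover have "j \<notin> incident_arrows Q v"
      using ys[OF j(1)] finv by (metis Max_ge a_def leD)
    ultimately show "fst e \<noteq> v \<and> snd e \<noteq> v"
      using j by (auto simp: incident_arrows_def)
  qed
  then have "swaps (arrow_list Q) v = swaps (map ?e xs) (other_end Q a v)"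
    using a transpose_other_end[of Q a v]
    by (simp add: arrow_list_def split swaps_append incident_arrows_def)
  also have "map ?e xs = take (length xs) (arrow_list Q)"
    by (simp add: arrow_list_def split)
  also have "swaps \<dots> (other_end Q a v) = snd (last ((a, other_end Q a v) # descend Q a (other_end Q a v)))"
  proof (rule swaps_arrow_prefix[OF fin])
    have "{j \<in> arcs Q. j < a} = {j \<in> set ?as. j < a}"
      using fin by simp
    also have "\<dots> = set xs"
      unfolding split using xs ys by (auto dest: order.asym)
    finally show "{j \<in> arcs Q. j < a} = set (take (length xs) ?as)"
      by (simp add: split)
  qed (simp add: split)
  finally show ?thesis
    by (simp add: xi_def descending_walk_def Let_def a_def)
qed

lemma incident_arrows_nonempty:
  assumes Q: "conn_loopless_quiver Q" and "arcs Q \<noteq> {}" and v: "v \<in> verts Q"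
  shows "incident_arrows Q v \<noteq> {}"
proof
  assume none: "incident_arrows Q v = {}"
  obtain a where a: "a \<in> arcs Q"
    using \<open>arcs Q \<noteq> {}\<close> by blast
  have "(tail Q a = v) = (v = v)"
  proof (rule connected_imp_constant[of Q "\<lambda>w. w = v"])
    show "wf_digraph Q" "Digraph_Component.connected Q" "tail Q a \<in> verts Q" "v \<in> verts Q"
      using conn_loopless_quiverD[OF Q] a v by auto
    show "(tail Q b = v) = (head Q b = v)" if "b \<in> arcs Q" for b
      using none that by (auto simp: incident_arrows_def)
  qed
  then show False
    using none a by (auto simp: incident_arrows_def)
qed

lemma orbit_xi:
  assumes Q: "conn_loopless_quiver Q" and "arcs Q \<noteq> {}" and v: "v \<in> verts Q"
  shows "orbit (xi Q) v = orbit (swaps (arrow_list Q)) v"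
proof -
  have xi: "xi Q w = swaps (arrow_list Q) w" if "w \<in> verts Q" for w
    using conn_loopless_quiverD[OF Q] incident_arrows_nonempty[OF assms(1,2) that]
    by (intro xi_eq_swaps)
  have "swaps (arrow_list Q) permutes verts Q"
    using arrow_list(1)[OF Q] by (rule swaps_permutes)
  then have "xi Q \<in> verts Q \<rightarrow> verts Q"
    using xi by (auto simp: permutes_in_image)
  then show ?thesis
    using v xi by (intro orbit_cong0)
qed

lemma mset_quiver_cycle_type:
  assumes Q: "conn_loopless_quiver Q" and "arcs Q \<noteq> {}"
  shows "mset (quiver_cycle_type Q) = image_mset card (mset_set (orbit (swaps (arrow_list Q)) ` verts Q))"
proof -
  have "orbit (xi Q) ` verts Q = orbit (swaps (arrow_list Q)) ` verts Q"
    using orbit_xi[OF assms] by (rule image_cong[OF refl])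
  then show ?thesis
    by (simp add: quiver_cycle_type_def)
qed

lemma char_partition_mset: "char_partition \<pi> = (\<Prod>k\<in>#mset \<pi>. monom 1 k - 1)"
proof -
  have "char_partition \<pi> = prod_list (map (\<lambda>k. monom 1 k - 1) \<pi>)"
    by (simp add: char_partition_def prod.list_conv_set_nth atLeast0LessThan)
  also have "\<dots> = (\<Prod>k\<in>#mset \<pi>. monom 1 k - 1)"
    by (induction \<pi>) auto
  finally show ?thesis .
qed

text \<open>
  The powers of \<open>\<lambda> - 1\<close> stay on both sides since \<open>card (arcs Q)\<close> may be smaller than
  \<open>card (verts Q)\<close>.
\<close>

lemma coxeter_poly_quiver_form:
  assumes Q: "conn_loopless_quiver Q" and "arcs Q \<noteq> {}"
  shows "[:-1, 1:] ^ card (verts Q) * coxeter_poly (card (arcs Q)) (quiver_form Q) =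
    [:-1, 1:] ^ card (arcs Q) * char_partition (quiver_cycle_type Q)"
proof -
  let ?p = "swaps (arrow_list Q)"
  note vs = vertex_list[OF Q] and es = arrow_list[OF Q]
  have p: "?p permutes verts Q"
    using es(1) by (rule swaps_permutes)
  have fin: "finite (verts Q)"
    using conn_loopless_quiverD[OF Q] by blast
  have "char_poly (fun_mat ?p (vertex_list Q) (vertex_list Q)) = (\<Prod>C\<in>orbit ?p ` verts Q. monom 1 (card C) - 1)"
    using char_poly_fun_mat_permutes[OF fin p vs(1)] vs(2) p by (simp add: permutes_in_image)
  also have "\<dots> = char_partition (quiver_cycle_type Q)"
    using fin by (simp add: char_partition_mset mset_quiver_cycle_type[OF assms] prod_unfold_prod_mset
        image_mset.compositionality comp_def)
  finally show ?thesis
    using char_poly_coxeter_gram_tri[of "vertex_list Q" "arrow_list Q"] vs es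
    by (simp add: coxeter_poly_def coxeter_mat_def tri_gram_quiver_form[OF Q])
qed

lemma partition_of_quiver_cycle_type:
  assumes Q: "conn_loopless_quiver Q" and "arcs Q \<noteq> {}"
  shows "partition_of (card (verts Q)) (quiver_cycle_type Q)"
proof -
  let ?p = "swaps (arrow_list Q)"
  let ?O = "orbit ?p ` verts Q"
  have p: "?p permutes verts Q"
    using arrow_list(1)[OF Q] by (rule swaps_permutes)
  have fin: "finite (verts Q)"
    using conn_loopless_quiverD[OF Q] by blast
  have perm: "permutation ?p"
    using fin p by (auto simp: permutation_permutes)
  have finO: "finite C" "C \<noteq> {}" if "C \<in> ?O" for C
    using that finite_orbit[OF permutation_self_in_orbit[OF perm]] orbit_nonempty[of ?p] by auto
  note m = mset_quiver_cycle_type[OF assms]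
  have "sorted_wrt (\<ge>) (quiver_cycle_type Q)"
    unfolding quiver_cycle_type_def sorted_wrt_rev
    using sorted_sorted_list_of_multiset[of "image_mset card (mset_set (orbit (xi Q) ` verts Q))"] by simp
  moreover have "0 < k" if "k \<in> set (quiver_cycle_type Q)" for k
  proof -
    have "k \<in># mset (quiver_cycle_type Q)"
      using that by simp
    then obtain C where "C \<in> ?O" "k = card C"
      unfolding m using fin by auto
    then show ?thesis
      using finO[of C] by (simp add: card_gt_0_iff)
  qed
  moreover have "sum_list (quiver_cycle_type Q) = card (verts Q)"
  proof -
    have "sum_list (quiver_cycle_type Q) = (\<Sum>C\<in>?O. card C)"
      using m by (simp add: sum_unfold_sum_mset flip: sum_mset_sum_list)
    also have "\<dots> = card (\<Union>?O)"
    proof (rule card_Union_disjoint[symmetric])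
      show "pairwise disjnt ?O"
      proof (rule pairwiseI)
        fix C D assume CD: "C \<in> ?O" "D \<in> ?O" "C \<noteq> D"
        then have "cyclic_on ?p C" "cyclic_on ?p D"
          using cyclic_on_orbit'[OF perm] by auto
        then show "disjnt C D"
          using CD(3) orbit_cyclic_eq3 unfolding disjnt_def by (metis disjoint_iff)
      qed
    qed (use finO in auto)
    also have "\<Union>?O = verts Q"
      using permutes_orbit_subset[OF p] permutation_self_in_orbit[OF perm] by blast
    finally show ?thesis .
  qed
  ultimately show ?thesis
    by (auto simp: partition_of_def)
qed

section \<open>The number of cycles\<close>

text \<open>
  Padded with zero rows, the system has a square matrix of determinant zero.
\<close>

lemma homogeneous_system_nontrivial:
  fixes c :: "nat \<Rightarrow> 'i \<Rightarrow> int"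
  assumes I: "finite I" and N: "N < card I"
  obtains z where "\<exists>i\<in>I. z i \<noteq> 0" "\<And>j. j < N \<Longrightarrow> (\<Sum>i\<in>I. z i * c j i) = 0"
proof -
  obtain xs where xs: "distinct xs" "set xs = I"
    using I finite_distinct_list by blast
  define K where "K = length xs"
  have K: "K = card I"
    using xs distinct_card unfolding K_def by metis
  define M where "M = mat K K (\<lambda>(j, i). if j < N then c j (xs ! i) else 0)"
  have M: "M \<in> carrier_mat K K" by (simp add: M_def)
  have "det M = (\<Sum>i<K. M $$ (N, i) * cofactor M N i)"
    using M N K by (intro laplace_expansion_row) auto
  also have "\<dots> = 0"
    using N K by (intro sum.neutral) (simp add: M_def)
  finally obtain v where v: "v \<in> carrier_vec K" "v \<noteq> 0\<^sub>v K" "M *\<^sub>v v = 0\<^sub>v K"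
    using det_0_iff_vec_prod_zero[OF M] by blast
  define z where "z x = v $ (THE i. i < K \<and> xs ! i = x)" for x
  have z: "z (xs ! i) = v $ i" if "i < K" for i
  proof -
    have "(THE j. j < K \<and> xs ! j = xs ! i) = i"
      using that xs(1) by (intro the_equality) (auto simp: K_def nth_eq_iff_index_eq)
    then show ?thesis by (simp add: z_def)
  qed
  show thesis
  proof (rule that)
    obtain i where "i < K" "v $ i \<noteq> 0"
      using v(1,2) by (metis carrier_vecD eq_vecI index_zero_vec)
    then show "\<exists>i\<in>I. z i \<noteq> 0"
      using z xs by (intro bexI[of _ "xs ! i"]) (auto simp: K_def)
    fix j assume j: "j < N"
    have "(\<Sum>i\<in>I. z i * c j i) = (\<Sum>i<K. z (xs ! i) * c j (xs ! i))"
      using sum_distinct_list[OF xs(1), of "\<lambda>x. z x * c j x"] xs(2) by (simp add: K_def)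
    also have "\<dots> = (\<Sum>i<K. M $$ (j, i) * v $ i)"
      using j N K by (intro sum.cong) (auto simp: M_def z)
    also have "\<dots> = (M *\<^sub>v v) $ j"
      using j N K M v(1) by (simp add: scalar_prod_def atLeast0LessThan)
    also have "\<dots> = 0"
      using v(3) j N K by simp
    finally show "(\<Sum>i\<in>I. z i * c j i) = 0" .
  qed
qed

lemma swaps_take_Suc:
  assumes "j < length es"
  shows "swaps (take (Suc j) es) v = swaps (take j es) (Transposition.transpose (fst (es ! j)) (snd (es ! j)) v)"
  by (simp add: take_Suc_conv_app_nth[OF assms] swaps_append)

text \<open>
  Let \<open>u\<^sub>j\<close> be the columns of the incidence matrix and \<open>P\<^sub>j\<close> the product of the first \<open>j\<close>
  transpositions. A function \<open>g\<close> on the vertices that is constant on the orbits yields a vector \<open>y\<close>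
  with \<open>y\<^sub>j = u\<^sub>j \<bullet> (g \<circ> P\<^sub>j)\<close>. Since \<open>y\<^sub>j u\<^sub>j = g \<circ> P\<^sub>j - g \<circ> P\<^sub>j\<^sub>+\<^sub>1\<close>, the sum of the \<open>y\<^sub>j u\<^sub>j\<close> vanishes; that
  is, \<open>y\<close> is orthogonal to all vectors \<open>w\<close> with \<open>w\<^sub>j = u\<^sub>j \<bullet> h\<close>, for \<open>h\<close> any function on the
  vertices. By connectedness, \<open>w = 0\<close> and \<open>y = 0\<close> force \<open>h\<close> and \<open>g\<close> to be constant. So two orthogonal
  spaces, of dimension \<open>card V - 1\<close> and of one less than the number of orbits, fit into
  dimension \<open>length es\<close>. The proof phrases this as the lack of nontrivial solutions of the
  system \<open>w + y = 0\<close>, normalised by \<open>h v\<^sub>0 = g v\<^sub>0 = 0\<close>.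
\<close>

lemma vertices_plus_orbits_le:
  fixes V :: "'v set"
  assumes V: "finite V" "V \<noteq> {}" and es: "edges_on V es"
    and conn: "\<And>f :: 'v \<Rightarrow> int. (\<And>e. e \<in> set es \<Longrightarrow> f (fst e) = f (snd e)) \<Longrightarrow>
      (\<And>u v. u \<in> V \<Longrightarrow> v \<in> V \<Longrightarrow> f u = f v)"
  shows "card V + card (orbit (swaps es) ` V) \<le> length es + 2"
proof (rule ccontr)
  assume contra: "\<not> ?thesis"
  let ?n = "length es"
  let ?P = "\<lambda>j. swaps (take j es)"
  let ?orb = "orbit (swaps es)"
  obtain v0 where v0: "v0 \<in> V" using V(2) by blast
  define I where "I = V <+> ?orb ` V"
  have I: "finite I" "?n + 2 < card I"
    using V contra by (auto simp: I_def card_Plus)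
  have perm: "swaps xs permutes V" if "edges_on V xs" for xs
    using that by (rule swaps_permutes)
  have Pin: "?P j v \<in> V" if "v \<in> V" for j v
  proof -
    have "edges_on V (take j es)"
      using es by (auto simp: edges_on_def dest: in_set_takeD)
    from perm[OF this] show ?thesis
      using that by (simp add: permutes_in_image)
  qed
  \<comment> \<open>The coefficients of the unknowns \<open>h\<close>, indexed by vertices, and \<open>g\<close>, indexed by orbits.\<close>
  define c where "c j = (if j < ?n then
      (\<lambda>i. edge_vec (Inl (fst (es ! j)), Inl (snd (es ! j))) i +
        edge_vec (Inr (?orb (?P j (fst (es ! j)))), Inr (?orb (?P j (snd (es ! j))))) i)
    else if j = ?n then (\<lambda>i. of_bool (i = Inl v0)) else (\<lambda>i. of_bool (i = Inr (?orb v0))))" for j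
  obtain z where nz: "\<exists>i\<in>I. z i \<noteq> 0" and z: "\<And>j. j < ?n + 2 \<Longrightarrow> (\<Sum>i\<in>I. z i * c j i) = 0"
    using homogeneous_system_nontrivial[OF I, of c] by metis
  define h where "h v = z (Inl v)" for v
  define g where "g v = z (Inr (?orb v))" for v
  define w where "w j = h (fst (es ! j)) - h (snd (es ! j))" for j
  define y where "y j = g (?P j (fst (es ! j))) - g (?P j (snd (es ! j)))" for j
  have wy: "w j + y j = 0" if j: "j < ?n" for j
  proof -
    note e = edges_on_nth[OF es j]
    have "(\<Sum>i\<in>I. z i * c j i) = w j + y j"
    proof -
      have "Inl (fst (es ! j)) \<in> I" "Inl (snd (es ! j)) \<in> I"
        "Inr (?orb (?P j (fst (es ! j)))) \<in> I" "Inr (?orb (?P j (snd (es ! j)))) \<in> I"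
        using e Pin by (auto simp: I_def)
      then show ?thesis
        using j by (simp add: c_def distrib_left sum.distrib sum_edge_vec[OF I(1)] w_def y_def h_def g_def)
    qed
    then show ?thesis
      using z[of j] j by simp
  qed
  have "(\<Sum>i\<in>I. z i * c ?n i) = h v0" "(\<Sum>i\<in>I. z i * c (Suc ?n) i) = g v0"
    using I(1) v0 by (auto simp: c_def h_def g_def I_def of_bool_def if_distrib[of "(*) _"] cong: if_cong)
  then have h0: "h v0 = 0" and g0: "g v0 = 0"
    using z[of ?n] z[of "Suc ?n"] by simp_all
  have g_inv: "g (swaps es v) = g v" if "v \<in> V" for v
  proof -
    have "permutation (swaps es)"
      using perm[OF es] V(1) by (auto simp: permutation_permutes)
    then show ?thesis
      by (simp add: g_def permutation_orbit_step)
  qed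
  have gP: "g (?P j v) - g (?P (Suc j) v) = y j * edge_vec (es ! j) v" if j: "j < ?n" for j v
    using edges_on_nth(3)[OF es j]
    by (auto simp: swaps_take_Suc[OF j] y_def edge_vec_def transpose_def)
  \<comment> \<open>A telescoping sum, as \<open>g\<close> is invariant under the product of all transpositions.\<close>
  have "(\<Sum>j<?n. y j * edge_vec (es ! j) v) = 0" if "v \<in> V" for v
  proof -
    have "(\<Sum>j<?n. y j * edge_vec (es ! j) v) = (\<Sum>j<?n. g (?P j v) - g (?P (Suc j) v))"
      using gP by simp
    also have "\<dots> = g (?P 0 v) - g (?P ?n v)"
      by (rule sum_lessThan_telescope')
    finally show ?thesis
      using g_inv[OF that] by simp
  qed
  then have "0 = (\<Sum>v\<in>V. h v * (\<Sum>j<?n. y j * edge_vec (es ! j) v))"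
    by simp
  also have "\<dots> = (\<Sum>j<?n. y j * (\<Sum>v\<in>V. h v * edge_vec (es ! j) v))"
    unfolding sum_distrib_left by (subst sum.swap) (simp add: ac_simps)
  also have "\<dots> = (\<Sum>j<?n. y j * w j)"
    using edges_on_nth[OF es] V(1) by (simp add: sum_edge_vec w_def)
  also have "\<dots> = (\<Sum>j<?n. - (y j)\<^sup>2)"
  proof (rule sum.cong)
    fix j assume "j \<in> {..<?n}"
    then have "w j = - y j" using wy[of j] by simp
    then show "y j * w j = - (y j)\<^sup>2" by (simp add: power2_eq_square)
  qed simp
  finally have "(\<Sum>j<?n. (y j)\<^sup>2) = 0"
    by (simp add: sum_negf)
  then have y: "y j = 0" if "j < ?n" for j
    using that by (simp add: sum_nonneg_eq_0_iff)
  then have w: "w j = 0" if "j < ?n" for j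
    using wy that by fastforce
  have "h u = 0" if "u \<in> V" for u
  proof -
    have "h (fst e) = h (snd e)" if "e \<in> set es" for e
      using that w by (auto simp: w_def in_set_conv_nth)
    then have "h u = h v0"
      using \<open>u \<in> V\<close> v0 by (rule conn)
    then show ?thesis using h0 by simp
  qed
  moreover have "g u = 0" if "u \<in> V" for u
  proof -
    have gP': "g (?P j v) = g v" if "j \<le> ?n" for j v
      using that
    proof (induction j)
      case (Suc j)
      then show ?case using gP[of j v] y[of j] by simp
    qed simp
    have "g (fst e) = g (snd e)" if "e \<in> set es" for e
      using that y gP' by (auto simp: y_def in_set_conv_nth)
    then have "g u = g v0"
      using \<open>u \<in> V\<close> v0 by (rule conn)
    then show ?thesis using g0 by simp
  qed
  ultimately show False
    using nz by (auto simp: I_def h_def g_def)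
qed

lemma poly_char_poly_0:
  fixes A :: "int mat"
  assumes A: "A \<in> carrier_mat n n"
  shows "poly (char_poly A) 0 = det (- A)"
proof -
  have "map_mat (\<lambda>p. poly p 0) (char_poly_matrix A) = - A"
    using A by (intro eq_matI) (auto simp: char_poly_matrix_def)
  moreover have "det (map_mat (\<lambda>p. poly p 0) (char_poly_matrix A)) = poly (det (char_poly_matrix A)) 0"
  proof (rule comm_ring_hom.hom_det)
    show "comm_ring_hom (\<lambda>p :: int poly. poly p 0)"
      by unfold_locales auto
  qed
  ultimately show ?thesis
    by (simp add: char_poly_def)
qed

text \<open>
  The negative of the Coxeter matrix is a product of two matrices of determinant one.
\<close>

lemma poly_coxeter_poly_0:
  assumes U: "tri_gram n q \<in> carrier_mat n n" "det (tri_gram n q) = 1"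
  shows "poly (coxeter_poly n q) 0 = 1"
proof -
  let ?U = "tri_gram n q" and ?W = "mat_inv (tri_gram n q)"
  note W = mat_inv_unimodular[OF U]
  have "det ?U * det ?W = 1"
    using det_mult[OF U(1) W(1)] W(2) by simp
  moreover have "- (- (?U\<^sup>T * ?W)) = ?U\<^sup>T * ?W"
    by (rule uminus_uminus_mat)
  ultimately show ?thesis
    using U W poly_char_poly_0[of "- (?U\<^sup>T * ?W)" n]
    by (simp add: coxeter_poly_def coxeter_mat_def det_mult[of _ n] det_transpose[OF U(1)])
qed

text \<open>
  The parity of the number of cycles comes from evaluating \<open>coxeter_poly_quiver_form\<close> at \<open>0\<close>.
\<close>

lemma quiver_cycle_type_in_P1:
  assumes Q: "conn_loopless_quiver Q" and "arcs Q \<noteq> {}"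
  shows "quiver_cycle_type Q \<in> P1 (card (arcs Q) + 1 - card (verts Q)) (card (verts Q))"
proof -
  let ?n = "card (arcs Q)" and ?m = "card (verts Q)" and ?ct = "quiver_cycle_type Q"
  note D = conn_loopless_quiverD[OF Q]
  have part: "partition_of ?m ?ct"
    using assms by (rule partition_of_quiver_cycle_type)
  have V: "verts Q \<noteq> {}"
    using \<open>arcs Q \<noteq> {}\<close> D(5) by blast
  have "length ?ct = size (mset ?ct)"
    by simp
  also have "\<dots> = card (orbit (swaps (arrow_list Q)) ` verts Q)"
    unfolding mset_quiver_cycle_type[OF assms] by simp
  finally have len: "length ?ct = card (orbit (swaps (arrow_list Q)) ` verts Q)" .
  have le: "?m + length ?ct \<le> ?n + 2"
    unfolding len arrow_list(2)[OF Q, symmetric]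
  proof (rule vertices_plus_orbits_le[OF D(1) V arrow_list(1)[OF Q]])
    fix f :: "'a \<Rightarrow> int" and u v
    assume f: "\<And>e. e \<in> set (arrow_list Q) \<Longrightarrow> f (fst e) = f (snd e)" and uv: "u \<in> verts Q" "v \<in> verts Q"
    show "f u = f v"
    proof (rule connected_imp_constant[OF D(3,4) _ uv])
      fix a assume "a \<in> arcs Q"
      then show "f (tail Q a) = f (head Q a)"
        using f[of "(tail Q a, head Q a)"] D(2) by (simp add: arrow_list_def)
    qed
  qed
  have "?ct \<noteq> []"
    using len V D(1) by auto
  then have "0 < length ?ct" by simp
  then have m: "?m \<le> ?n + 1"
    using le by linarith
  have "poly (coxeter_poly ?n (quiver_form Q)) 0 = 1"
    using gram_tri_unitriangular(2)[of "arrow_list Q"] carrier_graph_mats(2)[of "arrow_list Q"] arrow_list(2)[OF Q]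
    by (intro poly_coxeter_poly_0) (auto simp: tri_gram_quiver_form[OF Q])
  moreover have "poly (char_partition ?ct) 0 = (-1) ^ length ?ct"
    using part by (simp add: char_partition_def partition_of_def poly_prod poly_monom zero_power)
  ultimately have "(-1 :: int) ^ ?m = (-1) ^ ?n * (-1) ^ length ?ct"
    using arg_cong[OF coxeter_poly_quiver_form[OF assms], of "\<lambda>p. poly p 0"] by simp
  then have "(-1 :: int) ^ ?m = (-1) ^ (?n + length ?ct)"
    by (simp add: power_add)
  then have "even ?m = even (?n + length ?ct)"
    by (metis minus_one_power_iff one_neq_neg_one)
  then show "?ct \<in> P1 (?n + 1 - ?m) ?m"
    using part le m by (auto simp: P1_def of_nat_diff)
qed

section \<open>Recovering a partition from its polynomial\<close>

text \<open>
  A primitive \<open>M\<close>-th root of unity is a zero of \<open>x\<^sup>b - 1\<close> with \<open>0 < b \<le> M\<close> only for \<open>b = M\<close>.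
\<close>

lemma max_mem_of_prod_eq:
  assumes eq: "(\<Prod>a\<in>#A. monom 1 a - 1 :: int poly) = (\<Prod>b\<in>#B. monom 1 b - 1)"
    and M: "M \<in># A" "0 < M" and B: "\<And>b. b \<in># B \<Longrightarrow> 0 < b \<and> b \<le> M"
  shows "M \<in># B"
proof -
  define z where "z = cis (2 * pi / real M)"
  have ev: "poly (map_poly of_int (\<Prod>a\<in>#A. monom 1 a - 1 :: int poly)) z = (\<Prod>a\<in>#A. z ^ a - 1)" for A
    by (induction A) (simp_all add: hom_distribs poly_monom)
  have zpow: "z ^ k = cis (2 * pi * real k / real M)" for k
    by (simp add: z_def DeMoivre mult_ac)
  have "z ^ M = 1"
    using M(2) by (simp add: zpow)
  then have "(\<Prod>a\<in>#A. z ^ a - 1) = 0"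
    using M(1) by (auto simp: prod_mset_zero_iff intro!: image_eqI[of _ _ M])
  then have "(\<Prod>b\<in>#B. z ^ b - 1) = 0"
    using ev eq by metis
  then obtain b where b: "b \<in># B" "z ^ b = 1"
    by (auto simp: prod_mset_zero_iff)
  have "b = M"
  proof (rule ccontr)
    assume "b \<noteq> M"
    then have "b < M" using B[OF b(1)] by simp
    moreover have "inj_on (\<lambda>k. cis (2 * pi * real k / real M)) {..<M}"
      using bij_betw_roots_unity[OF M(2)] by (rule bij_betw_imp_inj_on)
    moreover have "cis (2 * pi * real b / real M) = cis (2 * pi * real 0 / real M)"
      using b(2) zpow by simp
    ultimately have "b = 0"
      using M(2) inj_onD[of "\<lambda>k. cis (2 * pi * real k / real M)" "{..<M}" b 0] by blast
    then show False using B[OF b(1)] by simp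
  qed
  then show ?thesis using b(1) by simp
qed

text \<open>
  The largest element of either multiset lies in both of them, and its factor can be
  cancelled.
\<close>

lemma prod_power_minus_one_inject:
  assumes "(\<Prod>a\<in>#A. monom 1 a - 1 :: int poly) = (\<Prod>b\<in>#B. monom 1 b - 1)"
    and "\<And>a. a \<in># A \<Longrightarrow> 0 < a" "\<And>b. b \<in># B \<Longrightarrow> 0 < b"
  shows "A = B"
  using assms
proof (induction "size A" arbitrary: A B)
  case 0
  have "B = {#}"
  proof (rule ccontr)
    assume "B \<noteq> {#}"
    then obtain b B' where "B = add_mset b B'"
      by (meson multiset_nonemptyE mset_add)
    then have "poly (\<Prod>b\<in>#B. monom 1 b - 1 :: int poly) 1 = 0"
      by (simp add: poly_monom)
    then show False using 0 by simp
  qed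
  then show ?case using 0 by simp
next
  case (Suc s)
  define M where "M = Max (set_mset (A + B))"
  have M: "M \<in># A + B"
    unfolding M_def using Suc.hyps(2) by (intro Max_in) auto
  have le: "a \<le> M" if "a \<in># A \<or> a \<in># B" for a
    unfolding M_def using that by (intro Max_ge) auto
  have MA: "M \<in># A"
  proof (cases "M \<in># B")
    case True
    show ?thesis
      by (rule max_mem_of_prod_eq[OF Suc.prems(1)[symmetric] True]) (use Suc.prems True le in auto)
  qed (use M in auto)
  have MB: "M \<in># B"
    by (rule max_mem_of_prod_eq[OF Suc.prems(1) MA]) (use Suc.prems MA le in auto)
  obtain A' B' where AB: "A = add_mset M A'" "B = add_mset M B'"
    using MA MB by (meson mset_add)
  have "poly (monom 1 M - 1 :: int poly) 0 \<noteq> 0"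
    using Suc.prems(2)[OF MA] by (simp add: poly_monom zero_power)
  then have "monom 1 M - 1 \<noteq> (0 :: int poly)"
    by (metis poly_0)
  then have "(\<Prod>a\<in>#A'. monom 1 a - 1 :: int poly) = (\<Prod>b\<in>#B'. monom 1 b - 1)"
    using Suc.prems(1) by (simp add: AB)
  then have "A' = B'"
    using Suc.hyps(2) Suc.prems(2,3) by (intro Suc.hyps(1)) (auto simp: AB)
  then show ?case by (simp add: AB)
qed

lemma partition_of_mset_inject:
  assumes "partition_of m \<pi>" "partition_of m' \<pi>'" and "mset \<pi> = mset \<pi>'"
  shows "\<pi> = \<pi>'"
proof -
  have "mset (rev \<pi>) = mset (rev \<pi>')" using assms(3) by simp
  moreover have "sorted (rev \<pi>)" "sorted (rev \<pi>')"
    using assms by (auto simp: partition_of_def sorted_wrt_rev)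
  ultimately have "rev \<pi> = rev \<pi>'"
    by (metis properties_for_sort sort_key_id_if_sorted sorted_sort_id)
  then show ?thesis by simp
qed

lemma char_partition_inject:
  assumes "partition_of m \<pi>" "partition_of m' \<pi>'" and "char_partition \<pi> = char_partition \<pi>'"
  shows "\<pi> = \<pi>'"
  using assms(1,2)
proof (rule partition_of_mset_inject)
  show "mset \<pi> = mset \<pi>'"
    using assms by (intro prod_power_minus_one_inject) (auto simp: partition_of_def char_partition_mset)
qed

section \<open>Forms of type \<open>\<bbbA>\<close> come from quivers\<close>

definition list_quiver :: "nat \<Rightarrow> (nat \<times> nat) list \<Rightarrow> (nat, nat) pre_digraph" where
  "list_quiver m es = \<lparr>verts = {0..<m}, arcs = {0..<length es},
     tail = (\<lambda>i. fst (es ! i)), head = (\<lambda>i. snd (es ! i))\<rparr>"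

lemma list_quiver_simps [simp]:
  "verts (list_quiver m es) = {0..<m}" "arcs (list_quiver m es) = {0..<length es}"
  "vertex_list (list_quiver m es) = [0..<m]" "arrow_list (list_quiver m es) = es"
  by (auto simp: list_quiver_def vertex_list_def arrow_list_def intro!: nth_equalityI)

lemma conn_loopless_list_quiver:
  assumes m: "0 < m" and es: "edges_on {0..<m} es"
    and const: "\<And>f :: nat \<Rightarrow> bool. (\<And>e. e \<in> set es \<Longrightarrow> f (fst e) = f (snd e)) \<Longrightarrow>
      (\<And>k. Suc k < m \<Longrightarrow> f k = f (Suc k))"
  shows "conn_loopless_quiver (list_quiver m es)"
proof -
  have wf: "fin_digraph (list_quiver m es)" "loopfree_digraph (list_quiver m es)"
    by unfold_locales (use edges_on_nth[OF es] in \<open>simp_all add: list_quiver_def\<close>)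
  moreover have "Digraph_Component.connected (list_quiver m es)"
  proof (rule connectedI_constant)
    show "wf_digraph (list_quiver m es)"
      using wf(1) by (simp add: fin_digraph_def)
    show "verts (list_quiver m es) \<noteq> {}"
      using m by auto
    fix f :: "nat \<Rightarrow> bool" and u v
    assume f: "\<And>a. a \<in> arcs (list_quiver m es) \<Longrightarrow> f (tail (list_quiver m es) a) = f (head (list_quiver m es) a)"
      and uv: "u \<in> verts (list_quiver m es)" "v \<in> verts (list_quiver m es)"
    have "f (fst e) = f (snd e)" if e: "e \<in> set es" for e
    proof -
      obtain i where "i < length es" "e = es ! i"
        using e by (auto simp: in_set_conv_nth)
      then show ?thesis
        using f[of i] by (simp add: list_quiver_def)
    qed
    note step = const[OF this]
    have zero: "f k = f 0" if "k < m" for k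
      using that
    proof (induction k)
      case (Suc k)
      then show ?case using step[of k] by simp
    qed simp
    show "f u = f v"
      using uv zero[of u] zero[of v] by simp
  qed
  ultimately show ?thesis
    unfolding conn_loopless_quiver_def by blast
qed

text \<open>
  The incidence matrix of the path \<open>0 \<rightarrow> 1 \<rightarrow> \<dots> \<rightarrow> r\<close>, followed by \<open>n - r\<close> zero columns. Half the squared norm
  of its image is the Dynkin form of type \<open>\<bbbA>\<^sub>r\<close> in \<open>n\<close> variables (\<open>path_mat_norm\<close>).
\<close>

definition path_mat :: "nat \<Rightarrow> nat \<Rightarrow> int mat" where
  "path_mat r n = mat (Suc r) n (\<lambda>(k, i). if i < r then edge_vec (i, Suc i) k else 0)"

lemma path_mat_carrier [simp]: "path_mat r n \<in> carrier_mat (Suc r) n"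
  by (simp add: path_mat_def)

lemma path_mat_mult_vec:
  assumes z: "z \<in> carrier_vec n" and r: "r \<le> n" and k: "k \<le> r"
  shows "(path_mat r n *\<^sub>v z) $ k = (if k < r then z $ k else 0) - (if k = 0 then 0 else z $ (k - 1))"
proof -
  have "(path_mat r n *\<^sub>v z) $ k = (\<Sum>i<n. (if i < r then edge_vec (i, Suc i) k else 0) * z $ i)"
    using z k by (simp add: path_mat_def scalar_prod_def atLeast0LessThan)
  also have "\<dots> = (\<Sum>i<n. (if i = k then if k < r then z $ k else 0 else 0) -
      (if i = k - 1 then if k = 0 then 0 else z $ (k - 1) else 0))"
    using k by (intro sum.cong) (auto simp: edge_vec_def)
  also have "\<dots> = (if k < r then z $ k else 0) - (if k = 0 then 0 else z $ (k - 1))"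
    using r k by (simp add: sum_subtractf sum.delta) auto
  finally show ?thesis .
qed

lemma sum_path_squares:
  fixes w :: "nat \<Rightarrow> int"
  shows "(\<Sum>k\<le>r. ((if k < r then w k else 0) - (if k = 0 then 0 else w (k - 1)))\<^sup>2) =
    2 * ((\<Sum>i<r. (w i)\<^sup>2) - (\<Sum>i<r - 1. w i * w (Suc i)))"
proof -
  have "(\<Sum>k\<le>r. ((if k < r then w k else 0) - (if k = 0 then 0 else w (k - 1)))\<^sup>2) =
      (\<Sum>k\<le>r. (if k < r then (w k)\<^sup>2 else 0)) + (\<Sum>k\<le>r. (if k = 0 then 0 else (w (k - 1))\<^sup>2))
      - 2 * (\<Sum>k\<le>r. if k < r \<and> k \<noteq> 0 then w k * w (k - 1) else 0)"
    unfolding sum.distrib[symmetric] sum_distrib_left sum_subtractf[symmetric]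
    by (intro sum.cong) (auto simp: power2_diff)
  also have "(\<Sum>k\<le>r. (if k < r then (w k)\<^sup>2 else 0)) = (\<Sum>i<r. (w i)\<^sup>2)"
    by (intro sum.mono_neutral_cong_right) auto
  also have "(\<Sum>k\<le>r. (if k = 0 then 0 else (w (k - 1))\<^sup>2)) = (\<Sum>i<r. (w i)\<^sup>2)"
    by (simp add: sum.atMost_shift)
  also have "(\<Sum>k\<le>r. if k < r \<and> k \<noteq> 0 then w k * w (k - 1) else 0) = (\<Sum>i<r - 1. w i * w (Suc i))"
    unfolding sum.atMost_shift by (simp, intro sum.mono_neutral_cong_right) auto
  finally show ?thesis by simp
qed

lemma path_mat_norm:
  assumes z: "z \<in> carrier_vec n" and r: "r \<le> n"
  shows "(path_mat r n *\<^sub>v z) \<bullet> (path_mat r n *\<^sub>v z) =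
    2 * ((\<Sum>i<r. (z $ i)\<^sup>2) - (\<Sum>i<r - 1. z $ i * z $ Suc i))"
proof -
  have "(path_mat r n *\<^sub>v z) \<bullet> (path_mat r n *\<^sub>v z) = (\<Sum>k\<le>r. ((path_mat r n *\<^sub>v z) $ k)\<^sup>2)"
    by (simp add: scalar_prod_def power2_eq_square path_mat_def atLeast0LessThan lessThan_Suc_atMost)
  also have "\<dots> = (\<Sum>k\<le>r. ((if k < r then z $ k else 0) - (if k = 0 then 0 else z $ (k - 1)))\<^sup>2)"
    using path_mat_mult_vec[OF z r] by (intro sum.cong) auto
  finally show ?thesis
    by (simp only: sum_path_squares)
qed

text \<open>
  There are a positive and a negative entry, and together they exhaust the norm.
\<close>

lemma norm_two_vector_is_edge:
  fixes w :: "'v \<Rightarrow> int"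
  assumes V: "finite V" and zero: "(\<Sum>v\<in>V. w v) = 0" and two: "(\<Sum>v\<in>V. (w v)\<^sup>2) = 2"
  obtains s t where "s \<in> V" "t \<in> V" "s \<noteq> t" "\<And>v. v \<in> V \<Longrightarrow> w v = edge_vec (s, t) v"
proof -
  have "\<exists>v\<in>V. w v \<noteq> 0"
    using two by (metis (mono_tags, lifting) power_zero_numeral sum.neutral zero_neq_numeral)
  then obtain v where v: "v \<in> V" "w v \<noteq> 0" by blast
  have "\<exists>s\<in>V. 0 < w s"
  proof (rule ccontr)
    assume "\<not> ?thesis"
    then have "\<forall>u\<in>V. 0 \<le> - w u" by (auto simp: not_less)
    then have "\<forall>u\<in>V. - w u = 0"
      using zero V sum_nonneg_eq_0_iff[of V "\<lambda>u. - w u"] by (simp add: sum_negf)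
    then show False using v by simp
  qed
  then obtain s where s: "s \<in> V" "0 < w s" by blast
  have "\<exists>t\<in>V. w t < 0"
  proof (rule ccontr)
    assume "\<not> ?thesis"
    then have "\<forall>u\<in>V. 0 \<le> w u" by (auto simp: not_less)
    then have "\<forall>u\<in>V. w u = 0"
      using zero V sum_nonneg_eq_0_iff[of V w] by simp
    then show False using v by simp
  qed
  then obtain t where t: "t \<in> V" "w t < 0" by blast
  have st: "s \<noteq> t" using s t by auto
  let ?R = "\<Sum>u\<in>V - {s} - {t}. (w u)\<^sup>2"
  have split: "(w s)\<^sup>2 + ((w t)\<^sup>2 + ?R) = 2"
    using two V s(1) t(1) st by (simp add: sum.remove[of V s] sum.remove[of "V - {s}" t])
  have sq: "1 \<le> (w s)\<^sup>2" "1 \<le> (w t)\<^sup>2" "0 \<le> ?R"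
    using s(2) t(2) by (auto intro!: sum_nonneg simp: int_one_le_iff_zero_less)
  then have "(w s)\<^sup>2 = 1" "(w t)\<^sup>2 = 1" "?R = 0"
    using split by linarith+
  then have "w s = 1" "w t = -1" "\<forall>u\<in>V - {s} - {t}. w u = 0"
    using s(2) t(2) V by (auto simp: power2_eq_1_iff sum_nonneg_eq_0_iff)
  then have "w u = edge_vec (s, t) u" if "u \<in> V" for u
    using that st by (auto simp: edge_vec_def)
  then show thesis
    using that s(1) t(1) st by blast
qed

lemma invertible_matE:
  fixes B :: "int mat"
  assumes "B \<in> carrier_mat n n" "invertible_mat B"
  obtains C where "C \<in> carrier_mat n n" "B * C = 1\<^sub>m n" "C * B = 1\<^sub>m n"
proof -
  obtain C where C: "B * C = 1\<^sub>m (dim_row B)" "C * B = 1\<^sub>m (dim_row C)"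
    using assms(2) by (auto simp: invertible_mat_def inverts_mat_def)
  have "dim_col C = n"
    using arg_cong[OF C(1), of dim_col] assms(1) by simp
  moreover have "dim_row C = n"
    using arg_cong[OF C(2), of dim_col] assms(1) by simp
  ultimately show thesis
    using that C assms(1) by (auto intro: carrier_matI)
qed

lemma quiver_form_list_quiver:
  assumes Q: "conn_loopless_quiver (list_quiver m es)" and x: "x \<in> carrier_vec (length es)"
  shows "quiver_form (list_quiver m es) x =
    ((inc_mat [0..<m] es *\<^sub>v x) \<bullet> (inc_mat [0..<m] es *\<^sub>v x)) div 2"
  using x by (simp add: quiver_form_def incidence_mat_eq[OF Q])

text \<open>
  Let \<open>B\<close> be the base change to the Dynkin form, \<open>C\<close> its inverse, \<open>D\<close> the path matrix and \<open>J = D C\<close>. Then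
  \<open>2 q(y) = \<parallel>J y\<parallel>\<^sup>2\<close>. The columns of \<open>J\<close> have norm two because \<open>q\<close> is a unit form, and their entries
  add up to zero because this holds for \<open>D\<close>. So \<open>J\<close> is the incidence matrix of a quiver. A function on its vertices that is constant along the arrows is
  orthogonal to the columns of \<open>J\<close>, hence to those of \<open>D = J B\<close>, and therefore constant along
  the path. So the quiver is connected.
\<close>

lemma UQuad_A_quiver:
  assumes cn: "c < n" and q: "q \<in> UQuad_A c n"
  obtains Q :: "(nat, nat) pre_digraph" where "conn_loopless_quiver Q" "card (arcs Q) = n"
    "card (verts Q) = n - c + 1" "quiver_form Q = q"
proof -
  define r where "r = n - c"
  have r: "0 < r" "r \<le> n" using cn by (auto simp: r_def)
  have int: "integral_form n q" and unit: "\<And>i. i < n \<Longrightarrow> tri_gram n q $$ (i, i) = 1"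
    and dyn: "dynkin_type_A n r q"
    using q by (auto simp: UQuad_A_def unit_form_def r_def)
  obtain B where B: "B \<in> carrier_mat n n" "invertible_mat B" and
    qB: "\<And>x. x \<in> carrier_vec n \<Longrightarrow> q (B *\<^sub>v x) = (\<Sum>i<r. (x $ i)\<^sup>2) - (\<Sum>i<r - 1. x $ i * x $ Suc i)"
    using dyn by (auto simp: dynkin_type_A_def)
  obtain C where C: "C \<in> carrier_mat n n" "B * C = 1\<^sub>m n" "C * B = 1\<^sub>m n"
    using B by (rule invertible_matE)
  let ?D = "path_mat r n"
  define J where "J = ?D * C"
  have D: "?D \<in> carrier_mat (Suc r) n" by simp
  have J: "J \<in> carrier_mat (Suc r) n"
    unfolding J_def using D C(1) by (rule mult_carrier_mat)
  have qJ: "(J *\<^sub>v y) \<bullet> (J *\<^sub>v y) = 2 * q y" if y: "y \<in> carrier_vec n" for y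
  proof -
    have "B *\<^sub>v (C *\<^sub>v y) = y"
      using assoc_mult_mat_vec[OF B(1) C(1) y] C(2) y by simp
    moreover have "J *\<^sub>v y = ?D *\<^sub>v (C *\<^sub>v y)"
      unfolding J_def using D C(1) y by (rule assoc_mult_mat_vec)
    ultimately show ?thesis
      using qB[of "C *\<^sub>v y"] path_mat_norm[of "C *\<^sub>v y" n r] r(2) C(1) y by simp
  qed
  have "\<exists>e. fst e < Suc r \<and> snd e < Suc r \<and> fst e \<noteq> snd e \<and> (\<forall>k<Suc r. J $$ (k, l) = edge_vec e k)"
    if l: "l < n" for l
  proof -
    have "q (unit_vec n l) = 1"
      using tri_gram_integral_form[OF int] unit[OF l] l by (simp add: scalar_prod_unit_mat)
    moreover have "J *\<^sub>v unit_vec n l = col J l"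
      using J l by (intro eq_vecI) auto
    ultimately have "col J l \<bullet> col J l = 2"
      using qJ[of "unit_vec n l"] by simp
    then have two: "(\<Sum>k\<in>{..<Suc r}. (J $$ (k, l))\<^sup>2) = 2"
      using J l by (simp add: scalar_prod_def power2_eq_square atLeast0LessThan del: sum.lessThan_Suc)
    have "(\<Sum>k\<in>{..<Suc r}. J $$ (k, l)) = (\<Sum>k\<in>{..<Suc r}. \<Sum>i<n. ?D $$ (k, i) * C $$ (i, l))"
      using C(1) l by (intro sum.cong) (auto simp: J_def scalar_prod_def atLeast0LessThan path_mat_def)
    also have "\<dots> = (\<Sum>i<n. (\<Sum>k\<in>{..<Suc r}. ?D $$ (k, i)) * C $$ (i, l))"
      unfolding sum_distrib_right by (rule sum.swap)
    also have "\<dots> = 0"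
    proof (intro sum.neutral ballI)
      fix i assume "i \<in> {..<n}"
      then have "(\<Sum>k\<in>{..<Suc r}. ?D $$ (k, i)) = (if i < r then \<Sum>k\<in>{..<Suc r}. 1 * edge_vec (i, Suc i) k else 0)"
        by (simp add: path_mat_def del: sum.lessThan_Suc)
      also have "\<dots> = 0"
        by (simp add: sum_edge_vec[of _ _ "\<lambda>_. 1", simplified] del: sum.lessThan_Suc)
      finally show "(\<Sum>k\<in>{..<Suc r}. ?D $$ (k, i)) * C $$ (i, l) = 0" by simp
    qed
    finally have zero: "(\<Sum>k\<in>{..<Suc r}. J $$ (k, l)) = 0" .
    obtain s t where "s \<in> {..<Suc r}" "t \<in> {..<Suc r}" "s \<noteq> t"
      "\<And>k. k \<in> {..<Suc r} \<Longrightarrow> J $$ (k, l) = edge_vec (s, t) k"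
      using norm_two_vector_is_edge[OF _ zero two] by blast
    then show ?thesis
      by (intro exI[of _ "(s, t)"]) auto
  qed
  then obtain e where e: "\<And>l. l < n \<Longrightarrow> fst (e l) < Suc r \<and> snd (e l) < Suc r \<and> fst (e l) \<noteq> snd (e l) \<and>
      (\<forall>k<Suc r. J $$ (k, l) = edge_vec (e l) k)"
    by metis
  define es where "es = map e [0..<n]"
  have len: "length es = n" by (simp add: es_def)
  have es: "edges_on {0..<Suc r} es"
    using e by (auto simp: edges_on_def es_def)
  have inc: "inc_mat [0..<Suc r] es = J"
    using e J by (intro eq_matI) (auto simp: inc_mat_def es_def simp del: upt_Suc)
  have JB: "J * B = ?D"
    unfolding J_def using assoc_mult_mat[OF D C(1) B(1)] C(3) D by simp
  have Q: "conn_loopless_quiver (list_quiver (Suc r) es)"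
  proof (rule conn_loopless_list_quiver[OF _ es])
    fix f :: "nat \<Rightarrow> bool" and k
    assume f: "\<And>e. e \<in> set es \<Longrightarrow> f (fst e) = f (snd e)" and "Suc k < Suc r"
    then have k: "k < r" "k < n" using r by auto
    let ?g = "\<lambda>v. of_bool (f v) :: int"
    have "?g k - ?g (Suc k) = (\<Sum>v\<in>{..<Suc r}. ?g v * edge_vec (k, Suc k) v)"
      by (subst sum_edge_vec) (use k in auto)
    also have "\<dots> = (\<Sum>v\<in>{..<Suc r}. ?g v * (J * B) $$ (v, k))"
      unfolding JB using k by (intro sum.cong) (auto simp: path_mat_def)
    also have "\<dots> = (\<Sum>v\<in>{..<Suc r}. \<Sum>l<n. ?g v * J $$ (v, l) * B $$ (l, k))"
      using J B(1) k by (intro sum.cong)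
        (auto simp: scalar_prod_def atLeast0LessThan sum_distrib_left mult.assoc)
    also have "\<dots> = (\<Sum>l<n. (\<Sum>v\<in>{..<Suc r}. ?g v * J $$ (v, l)) * B $$ (l, k))"
      unfolding sum_distrib_right by (rule sum.swap)
    also have "\<dots> = 0"
    proof (intro sum.neutral ballI)
      fix l assume l: "l \<in> {..<n}"
      then have "(\<Sum>v\<in>{..<Suc r}. ?g v * J $$ (v, l)) = (\<Sum>v\<in>{..<Suc r}. ?g v * edge_vec (e l) v)"
        using e by (intro sum.cong) auto
      also have "\<dots> = ?g (fst (e l)) - ?g (snd (e l))"
        using e[of l] l by (intro sum_edge_vec) auto
      also have "\<dots> = 0"
        using f[of "e l"] l by (simp add: es_def)
      finally show "(\<Sum>v\<in>{..<Suc r}. ?g v * J $$ (v, l)) * B $$ (l, k) = 0" by simp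
    qed
    finally show "f k = f (Suc k)"
      by (auto simp: of_bool_def split: if_splits)
  qed simp
  have "quiver_form (list_quiver (Suc r) es) = q"
  proof (rule extensionalityI)
    show "quiver_form (list_quiver (Suc r) es) \<in> extensional (carrier_vec n)"
      by (simp add: quiver_form_def len)
    show "q \<in> extensional (carrier_vec n)"
      using int by (auto simp: integral_form_def)
    fix x :: "int vec" assume "x \<in> carrier_vec n"
    then show "quiver_form (list_quiver (Suc r) es) x = q x"
      using qJ[of x] by (simp add: quiver_form_list_quiver[OF Q] len inc del: upt_Suc)
  qed
  then show thesis
    using that[OF Q] len by (simp add: r_def)
qed

section \<open>Quivers that contain a path through all vertices\<close>

lemma rank_le_card_terms:
  fixes A :: "rat mat"
  assumes I: "finite I" and A: "A \<in> carrier_mat n nc"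
    and entries: "\<And>k l. k < n \<Longrightarrow> l < nc \<Longrightarrow> A $$ (k, l) = (\<Sum>i\<in>I. f i k * g i l)"
  shows "vec_space.rank n A \<le> card I"
  using I A entries
proof (induction I arbitrary: A)
  case empty
  then have "A = 0\<^sub>m n nc"
    by (intro eq_matI) auto
  then show ?case
    by (simp add: vec_space.rank_0I)
next
  case (insert j I)
  define X where "X = mat n nc (\<lambda>(k, l). f j k * g j l)"
  define Y where "Y = mat n nc (\<lambda>(k, l). \<Sum>i\<in>I. f i k * g i l)"
  have XY: "X \<in> carrier_mat n nc" "Y \<in> carrier_mat n nc" "A = X + Y"
    using insert by (auto simp: X_def Y_def intro!: eq_matI)
  have "vec_space.rank n X \<le> 1"
    by (rule vec_space.rank_le_1_product_entries[OF XY(1), of "f j" "g j"]) (auto simp: X_def)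
  moreover have "vec_space.rank n Y \<le> card I"
    by (rule insert.IH[OF XY(2)]) (simp add: Y_def)
  ultimately show ?case
    using vec_space.rank_subadditive[OF XY(1,2)] insert.hyps by (simp add: XY(3))
qed

lemma scalar_prod_self_nonneg: "0 \<le> (x :: int vec) \<bullet> x"
  by (auto simp: scalar_prod_def intro!: sum_nonneg)

lemma scalar_prod_self_eq_0:
  fixes x :: "int vec"
  assumes "x \<bullet> x = 0" "i < dim_vec x"
  shows "x $ i = 0"
proof -
  have "\<forall>i\<in>{0..<dim_vec x}. x $ i * x $ i = 0"
    using assms(1) by (subst (asm) scalar_prod_def) (simp add: sum_nonneg_eq_0_iff)
  then show ?thesis using assms(2) by simp
qed

lemma path_mat_mult_vec_eq_0:
  assumes z: "z \<in> carrier_vec n" and r: "r \<le> n" and zero: "\<And>k. k \<le> r \<Longrightarrow> (path_mat r n *\<^sub>v z) $ k = 0"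
    and i: "i < r"
  shows "z $ i = 0"
  using i
proof (induction i)
  case 0
  then show ?case using zero[of 0] path_mat_mult_vec[OF z r, of 0] by simp
next
  case (Suc i)
  then show ?case using zero[of "Suc i"] path_mat_mult_vec[OF z r, of "Suc i"] by simp
qed

text \<open>
  The matrix \<open>A\<^sup>T A\<close> is a sum of \<open>r\<close> matrices of rank at most one, because only \<open>r\<close> columns of the path
  matrix are nonzero. Conversely, \<open>A\<^sup>T A + F\<^sup>T F\<close> is positive definite when \<open>F\<close> consists of the other
  \<open>n - r\<close> rows of \<open>C\<close>, and \<open>F\<^sup>T F\<close> has rank at most \<open>n - r\<close>.
\<close>

lemma rank_gram_path:
  assumes r: "r \<le> n" and C: "C \<in> carrier_mat n n" "det C = 1" and A: "A = path_mat r n * C"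
  shows "vec_space.rank n (map_mat rat_of_int (A\<^sup>T * A)) = r"
proof (rule antisym)
  let ?D = "path_mat r n"
  let ?h = "map_mat rat_of_int"
  have D: "?D \<in> carrier_mat (Suc r) n" by simp
  have Ac: "A \<in> carrier_mat (Suc r) n"
    unfolding A using D C(1) by (rule mult_carrier_mat)
  have G: "?h (A\<^sup>T * A) \<in> carrier_mat n n"
    using Ac by auto
  have At: "A\<^sup>T * A = C\<^sup>T * (?D\<^sup>T * A)"
    using C(1) D Ac by (simp add: A transpose_mult[OF D C(1)] assoc_mult_mat[of _ n n _ "Suc r" _ n])
  define K where "K = ?D\<^sup>T * A"
  have K: "K \<in> carrier_mat n n" "\<And>i l. r \<le> i \<Longrightarrow> i < n \<Longrightarrow> l < n \<Longrightarrow> K $$ (i, l) = 0"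
    using D Ac by (auto simp: K_def path_mat_def scalar_prod_def)
  have entry: "(A\<^sup>T * A) $$ (k, l) = (\<Sum>i<r. C $$ (i, k) * K $$ (i, l))" if "k < n" "l < n" for k l
  proof -
    have "(A\<^sup>T * A) $$ (k, l) = (\<Sum>i<n. C $$ (i, k) * K $$ (i, l))"
      unfolding At K_def[symmetric] using that C(1) K(1) by (simp add: scalar_prod_def atLeast0LessThan)
    also have "\<dots> = (\<Sum>i<r. C $$ (i, k) * K $$ (i, l))"
      using that r K(2) by (intro sum.mono_neutral_right) auto
    finally show ?thesis .
  qed
  have "vec_space.rank n (?h (A\<^sup>T * A)) \<le> card {..<r}"
    by (rule rank_le_card_terms[OF _ G, of _ "\<lambda>i k. of_int (C $$ (i, k))" "\<lambda>i l. of_int (K $$ (i, l))"])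
      (use Ac entry in auto)
  then show "vec_space.rank n (?h (A\<^sup>T * A)) \<le> r" by simp

  define F where "F = mat n n (\<lambda>(i, l). if i < r then 0 else C $$ (i, l))"
  have F: "F \<in> carrier_mat n n" by (simp add: F_def)
  have FF: "?h (F\<^sup>T * F) \<in> carrier_mat n n" using F by auto
  have "vec_space.rank n (?h (F\<^sup>T * F)) \<le> card {r..<n}"
  proof (rule rank_le_card_terms[OF _ FF, of _ "\<lambda>i k. of_int (C $$ (i, k))" "\<lambda>i l. of_int (C $$ (i, l))"])
    fix k l assume kl: "k < n" "l < n"
    have "(F\<^sup>T * F) $$ (k, l) = (\<Sum>i<n. F $$ (i, k) * F $$ (i, l))"
      using kl F by (simp add: scalar_prod_def atLeast0LessThan)
    also have "\<dots> = (\<Sum>i\<in>{r..<n}. C $$ (i, k) * C $$ (i, l))"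
      using kl by (intro sum.mono_neutral_cong_right) (auto simp: F_def)
    finally show "?h (F\<^sup>T * F) $$ (k, l) = (\<Sum>i\<in>{r..<n}. of_int (C $$ (i, k)) * of_int (C $$ (i, l)))"
      using kl F by simp
  qed simp
  then have rF: "vec_space.rank n (?h (F\<^sup>T * F)) \<le> n - r" by simp
  let ?H = "A\<^sup>T * A + F\<^sup>T * F"
  have H: "?H \<in> carrier_mat n n" using Ac F by auto
  have "det ?H \<noteq> 0"
  proof
    assume "det ?H = 0"
    then obtain x where x: "x \<in> carrier_vec n" "x \<noteq> 0\<^sub>v n" "?H *\<^sub>v x = 0\<^sub>v n"
      using det_0_iff_vec_prod_zero[OF H] by blast
    have "0 = x \<bullet> (?H *\<^sub>v x)"
      using x by simp
    also have "\<dots> = (A *\<^sub>v x) \<bullet> (A *\<^sub>v x) + (F *\<^sub>v x) \<bullet> (F *\<^sub>v x)"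
      using Ac F x(1) by (simp add: add_mult_distrib_mat_vec[of _ n n] scalar_prod_add_distrib[of _ n]
          flip: scalar_prod_gram)
    finally have "(A *\<^sub>v x) \<bullet> (A *\<^sub>v x) = 0" "(F *\<^sub>v x) \<bullet> (F *\<^sub>v x) = 0"
      using scalar_prod_self_nonneg[of "A *\<^sub>v x"] scalar_prod_self_nonneg[of "F *\<^sub>v x"] by linarith+
    note zero = scalar_prod_self_eq_0[OF this(1)] scalar_prod_self_eq_0[OF this(2)]
    have Cx: "C *\<^sub>v x \<in> carrier_vec n" using C(1) x(1) by simp
    have Ax: "A *\<^sub>v x = ?D *\<^sub>v (C *\<^sub>v x)"
      unfolding A using D C(1) x(1) by (rule assoc_mult_mat_vec)
    have "(?D *\<^sub>v (C *\<^sub>v x)) $ k = 0" if "k \<le> r" for k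
      unfolding Ax[symmetric] using that Ac by (intro zero(1)) simp
    then have low: "(C *\<^sub>v x) $ i = 0" if "i < r" for i
      using that by (rule path_mat_mult_vec_eq_0[OF Cx r])
    have high: "(C *\<^sub>v x) $ i = 0" if "r \<le> i" "i < n" for i
    proof -
      have "row C i = row F i"
        using that C(1) by (intro eq_vecI) (auto simp: F_def)
      then show ?thesis
        using zero(2)[of i] that C(1) F by simp
    qed
    have "C *\<^sub>v x = 0\<^sub>v n"
    proof (rule eq_vecI)
      fix i assume "i < dim_vec (0\<^sub>v n :: int vec)"
      then show "(C *\<^sub>v x) $ i = 0\<^sub>v n $ i"
        using low[of i] high[of i] by (cases "i < r") auto
    qed (use C(1) in simp)
    then show False
      using det_0_iff_vec_prod_zero[OF C(1)] C(2) x by auto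
  qed
  then have "det (?h ?H) \<noteq> 0" by simp
  then have "vec_space.rank n (?h ?H) = n"
    using H vec_space.det_rank_iff[of "?h ?H" n] by simp
  also have "?h ?H = ?h (A\<^sup>T * A) + ?h (F\<^sup>T * F)"
    using Ac F by (intro eq_matI) auto
  finally show "r \<le> vec_space.rank n (?h (A\<^sup>T * A))"
    using vec_space.rank_subadditive[OF G FF] rF r by linarith
qed

lemma list_quiver_form_in_UQuad_A:
  fixes es :: "(nat \<times> nat) list" and r :: nat
  defines "n \<equiv> length es" and "q \<equiv> quiver_form (list_quiver (Suc r) es)"
  assumes r: "0 < r" "r \<le> n" and Q: "conn_loopless_quiver (list_quiver (Suc r) es)"
    and C: "C \<in> carrier_mat n n" "det C = 1" and inc: "inc_mat [0..<Suc r] es = path_mat r n * C"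
    and conn: "connected_form n q"
  shows "q \<in> UQuad_A (n - r) n"
proof -
  let ?A = "inc_mat [0..<Suc r] es"
  have tri: "tri_gram n q = gram_tri es"
    using tri_gram_quiver_form[OF Q] by (simp add: n_def q_def)
  have U: "gram_tri es \<in> carrier_mat n n" "upper_triangular (gram_tri es)"
    by (simp_all add: n_def gram_tri_unitriangular)
  have ext: "q \<in> extensional (carrier_vec n)"
    by (simp add: q_def quiver_form_def n_def)
  have qx: "q x = ((?A *\<^sub>v x) \<bullet> (?A *\<^sub>v x)) div 2" if "x \<in> carrier_vec n" for x
    using quiver_form_list_quiver[OF Q] that unfolding q_def n_def by simp
  have "unit_form n q"
    unfolding unit_form_def tri
  proof (intro conjI allI impI)
    show "integral_form n q"
      using U ext quiver_form_eq[OF Q] by (intro integral_formI) (auto simp: q_def n_def)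
    show "gram_tri es $$ (i, i) = 1" if "i < n" for i
      using that by (simp add: gram_tri_def n_def)
  qed
  moreover have "nonneg_form n q"
    using scalar_prod_self_nonneg by (auto simp: nonneg_form_def qx pos_imp_zdiv_nonneg_iff)
  moreover have "corank n q = n - r"
  proof -
    have "sym_gram n q = ?A\<^sup>T * ?A"
      unfolding sym_gram_def tri using arrow_list(1)[OF Q]
      by (intro inc_mat_gram[symmetric]) (auto simp del: upt_Suc)
    then show ?thesis
      using rank_gram_path[OF r(2) C inc] by (simp add: corank_def)
  qed
  moreover have "dynkin_type_A n (n - (n - r)) q"
  proof -
    note adj = adj_mat[OF C(1)]
    let ?B = "adj_mat C"
    have CB: "C * ?B = 1\<^sub>m n" "?B * C = 1\<^sub>m n"
      using adj C(2) by auto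
    have "invertible_mat ?B"
      using adj(1) C(1) CB by (auto simp: invertible_mat_def inverts_mat_def intro!: exI[of _ C])
    moreover have "q (?B *\<^sub>v x) = (\<Sum>i<r. (x $ i)\<^sup>2) - (\<Sum>i<r - 1. x $ i * x $ Suc i)"
      if x: "x \<in> carrier_vec n" for x
    proof -
      have Bx: "?B *\<^sub>v x \<in> carrier_vec n" using adj(1) x by simp
      have "?A *\<^sub>v (?B *\<^sub>v x) = path_mat r n *\<^sub>v (C *\<^sub>v (?B *\<^sub>v x))"
        unfolding inc using C(1) Bx by (intro assoc_mult_mat_vec[of _ "Suc r" n]) auto
      also have "C *\<^sub>v (?B *\<^sub>v x) = x"
        using assoc_mult_mat_vec[OF C(1) adj(1) x] CB(1) x by simp
      finally show ?thesis
        using qx[OF Bx] path_mat_norm[OF x r(2)] by simp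
    qed
    ultimately show ?thesis
      using adj(1) r(2) unfolding dynkin_type_A_def by auto
  qed
  ultimately show ?thesis
    using conn by (simp add: UQuad_A_def)
qed

lemma edge_vec_telescope:
  assumes "s \<le> t"
  shows "(\<Sum>i\<in>{s..<t}. edge_vec (i, Suc i) k) = edge_vec (s, t) k"
  using sum_Suc_diff'[OF assms, of "\<lambda>i. - of_bool (i = k) :: int"] by (simp add: edge_vec_def)

text \<open>
  The first \<open>r\<close> arrows form a path through all vertices. The column of a further arrow from \<open>s\<close>
  to \<open>t\<close> is the sum of the columns of the path between \<open>s\<close> and \<open>t\<close>, so the incidence matrix
  is the path matrix times a unitriangular matrix \<open>C\<close>. The form is connected because adjacent arrows
  of the path, and a further arrow and the path arrow starting at its source, have
  nonzero scalar product.
\<close>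

lemma path_quiver_form_in_UQuad_A:
  fixes fs :: "(nat \<times> nat) list"
  defines "es \<equiv> \<lambda>r. map (\<lambda>i. (i, Suc i)) [0..<r] @ fs"
  assumes r: "0 < r" and fs: "\<forall>e\<in>set fs. fst e < snd e \<and> snd e \<le> r"
  shows "conn_loopless_quiver (list_quiver (Suc r) (es r))"
    "quiver_form (list_quiver (Suc r) (es r)) \<in> UQuad_A (length fs) (r + length fs)"
proof -
  let ?es = "es r"
  define n where "n = r + length fs"
  have len: "length ?es = n"
    by (simp add: es_def n_def)
  have low: "?es ! i = (i, Suc i)" if "i < r" for i
    using that by (simp add: es_def nth_append)
  have high: "fst (?es ! j) < snd (?es ! j)" "snd (?es ! j) \<le> r" if "r \<le> j" "j < n" for j
    using that bspec[OF fs, of "fs ! (j - r)"] by (auto simp: es_def nth_append n_def)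
  have es: "edges_on {0..<Suc r} ?es"
    using fs by (force simp: edges_on_def es_def)
  show Q: "conn_loopless_quiver (list_quiver (Suc r) ?es)"
  proof (rule conn_loopless_list_quiver[OF _ es])
    fix f :: "nat \<Rightarrow> bool" and k
    assume f: "\<And>e. e \<in> set ?es \<Longrightarrow> f (fst e) = f (snd e)" and k: "Suc k < Suc r"
    show "f k = f (Suc k)"
      using f[of "(k, Suc k)"] k by (simp add: es_def)
  qed simp
  define C where "C = mat n n (\<lambda>(i, j). if i = j then 1 else
    if r \<le> j \<and> fst (?es ! j) \<le> i \<and> i < snd (?es ! j) then 1 else 0 :: int)"
  have C: "C \<in> carrier_mat n n" by (simp add: C_def)
  moreover have "det C = 1"
  proof (rule det_unitriangular[OF C])
    show "upper_triangular C"
      using high by (fastforce simp: C_def intro!: upper_triangularI)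
  qed (simp add: C_def)
  moreover have "inc_mat [0..<Suc r] ?es = path_mat r n * C"
  proof (rule eq_matI)
    fix k j assume "k < dim_row (path_mat r n * C)" "j < dim_col (path_mat r n * C)"
    then have k: "k < Suc r" and j: "j < n"
      by (simp_all add: path_mat_def C_def)
    have "(path_mat r n * C) $$ (k, j) = (\<Sum>i<n. path_mat r n $$ (k, i) * C $$ (i, j))"
      using k j C by (simp add: scalar_prod_def atLeast0LessThan path_mat_def)
    also have "\<dots> = edge_vec (?es ! j) k"
    proof (cases "j < r")
      case True
      have "(\<Sum>i<n. path_mat r n $$ (k, i) * C $$ (i, j)) = (\<Sum>i<n. if i = j then path_mat r n $$ (k, j) else 0)"
        using True j by (intro sum.cong) (auto simp: C_def)
      then show ?thesis
        using True j k low[OF True] by (simp add: path_mat_def)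
    next
      case False
      then have hj: "fst (?es ! j) < snd (?es ! j)" "snd (?es ! j) \<le> r"
        using high[of j] j by auto
      have "(\<Sum>i<n. path_mat r n $$ (k, i) * C $$ (i, j)) =
          (\<Sum>i\<in>{fst (?es ! j)..<snd (?es ! j)}. edge_vec (i, Suc i) k)"
        using False j k hj by (intro sum.mono_neutral_cong_right) (auto simp: C_def path_mat_def n_def)
      then show ?thesis
        using hj edge_vec_telescope[of "fst (?es ! j)" "snd (?es ! j)" k] by simp
    qed
    finally show "inc_mat [0..<Suc r] ?es $$ (k, j) = (path_mat r n * C) $$ (k, j)"
      using k j len by (simp add: inc_mat_def del: upt_Suc)
  qed (use C len in \<open>auto simp: inc_mat_def path_mat_def\<close>)
  moreover have "connected_form n (quiver_form (list_quiver (Suc r) ?es))"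
  proof -
    let ?q = "quiver_form (list_quiver (Suc r) ?es)"
    have tri: "tri_gram n ?q = gram_tri ?es"
      using tri_gram_quiver_form[OF Q] len by simp
    show ?thesis
      unfolding connected_form_def
    proof (rule connectedI_constant)
      show "wf_digraph (form_graph n ?q)"
        by unfold_locales (auto simp: form_graph_def)
      show "verts (form_graph n ?q) \<noteq> {}"
        using r by (auto simp: form_graph_def n_def)
      fix f :: "nat \<Rightarrow> bool" and u v
      assume f: "\<And>a. a \<in> arcs (form_graph n ?q) \<Longrightarrow> f (tail (form_graph n ?q) a) = f (head (form_graph n ?q) a)"
        and uv: "u \<in> verts (form_graph n ?q)" "v \<in> verts (form_graph n ?q)"
      have adj: "f i = f j" if "i < j" "j < n" "edge_dot (?es ! i) (?es ! j) \<noteq> 0" for i j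
        using f[of "(i, j)"] that len by (simp add: form_graph_def tri gram_tri_def)
      have path: "f i = f 0" if "i < r" for i
        using that
      proof (induction i)
        case (Suc i)
        then show ?case
          using adj[of i "Suc i"] low[of i] low[of "Suc i"]
          by (simp add: n_def edge_dot_def edge_vec_def)
      qed simp
      have all: "f j = f 0" if "j < n" for j
      proof (cases "j < r")
        case False
        then have hj: "fst (?es ! j) < snd (?es ! j)" "snd (?es ! j) \<le> r"
          using high[of j] that by auto
        then have "f (fst (?es ! j)) = f j"
          using adj[of "fst (?es ! j)" j] low[of "fst (?es ! j)"] False that
          by (simp add: edge_dot_def edge_vec_def)
        then show ?thesis
          using path[of "fst (?es ! j)"] hj by simp
      qed (rule path)
      show "f u = f v"
        using all[of u] all[of v] uv by (simp add: form_graph_def)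
    qed
  qed
  ultimately show "quiver_form (list_quiver (Suc r) ?es) \<in> UQuad_A (length fs) (r + length fs)"
    using list_quiver_form_in_UQuad_A[of r ?es C] r Q len by (simp add: n_def)
qed

section \<open>A quiver for each partition\<close>

lemma swaps_zip_tl: "swaps (zip xs (tl xs)) = cycle_of_list xs"
proof (induction xs rule: cycle_of_list.induct)
  case (1 i j cs)
  then show ?case by (simp add: fun_eq_iff)
qed auto

lemma swaps_zip_tl_flipped: "swaps (zip (tl xs) xs) = cycle_of_list xs"
proof (induction xs rule: cycle_of_list.induct)
  case (1 i j cs)
  then show ?case by (simp add: fun_eq_iff transpose_commute[of j i])
qed auto

lemma cycle_of_list_nth:
  assumes "distinct xs" "i < length xs"
  shows "cycle_of_list xs (xs ! i) = xs ! (Suc i mod length xs)"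
proof -
  have "map (cycle_of_list xs) xs = rotate1 xs"
    using cyclic_rotation[OF assms(1), of 1] by simp
  then have "map (cycle_of_list xs) xs ! i = rotate1 xs ! i" by simp
  then show ?thesis
    using assms(2) by (simp add: nth_rotate1)
qed

lemma swaps_replicate_even: "swaps (replicate (2 * k) e) = id"
  by (induction k) (simp_all add: fun_eq_iff)

text \<open>
  The intervals \<open>{offset \<pi> a..<offset \<pi> (Suc a)}\<close> are blocks of vertices whose sizes are the
  parts of \<open>\<pi>\<close>.
\<close>

definition offset :: "nat list \<Rightarrow> nat \<Rightarrow> nat" where
  "offset \<pi> a = sum_list (take a \<pi>)"

lemma offset_0 [simp]: "offset \<pi> 0 = 0"
  by (simp add: offset_def)

lemma offset_Suc: "a < length \<pi> \<Longrightarrow> offset \<pi> (Suc a) = offset \<pi> a + \<pi> ! a"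
  by (simp add: offset_def take_Suc_conv_app_nth)

lemma offset_length [simp]: "offset \<pi> (length \<pi>) = sum_list \<pi>"
  by (simp add: offset_def)

lemma offset_mono:
  assumes "a \<le> b" "b \<le> length \<pi>"
  shows "offset \<pi> a \<le> offset \<pi> b"
  using assms
proof (induction b)
  case (Suc b)
  then show ?case
    using offset_Suc[of b \<pi>] by (cases "a = Suc b") auto
qed simp

lemma offset_strict_mono:
  assumes pos: "\<forall>k\<in>set \<pi>. 0 < k" and "a < b" "b \<le> length \<pi>"
  shows "offset \<pi> a < offset \<pi> b"
proof -
  have "offset \<pi> a < offset \<pi> (Suc a)"
    using bspec[OF pos, of "\<pi> ! a"] assms(2,3) by (simp add: offset_Suc)
  also have "\<dots> \<le> offset \<pi> b"
    using assms(2,3) by (intro offset_mono) auto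
  finally show ?thesis .
qed

lemma offset_block:
  assumes "k \<le> length \<pi>" "v < offset \<pi> k"
  shows "\<exists>a i. a < k \<and> i < \<pi> ! a \<and> v = offset \<pi> a + i"
  using assms
proof (induction k)
  case (Suc k)
  show ?case
  proof (cases "v < offset \<pi> k")
    case True
    then obtain a i where "a < k" "i < \<pi> ! a" "v = offset \<pi> a + i"
      using Suc by auto
    then show ?thesis
      using less_SucI by blast
  next
    case False
    then have "v - offset \<pi> k < \<pi> ! k" "v = offset \<pi> k + (v - offset \<pi> k)"
      using Suc.prems by (simp_all add: offset_Suc)
    then show ?thesis
      by blast
  qed
qed simp

lemma orbit_cards_of_blocks:
  assumes pos: "\<forall>k\<in>set \<pi>. 0 < k"
    and p: "\<And>a i. a < length \<pi> \<Longrightarrow> i < \<pi> ! a \<Longrightarrow> p (offset \<pi> a + i) = offset \<pi> a + Suc i mod \<pi> ! a"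
  shows "image_mset card (mset_set (orbit p ` {0..<sum_list \<pi>})) = mset \<pi>"
proof -
  define B where "B a = {offset \<pi> a..<offset \<pi> (Suc a)}" for a
  have orb: "orbit p (offset \<pi> a + i) = B a" if a: "a < length \<pi>" and i: "i < \<pi> ! a" for a i
  proof -
    have pow: "(p ^^ t) (offset \<pi> a + i) = offset \<pi> a + (i + t) mod \<pi> ! a" for t
      using i p[OF a, of "(i + _) mod \<pi> ! a"] by (induction t) (auto simp: mod_Suc_eq)
    have per: "(p ^^ (\<pi> ! a)) (offset \<pi> a + i) = offset \<pi> a + i"
      using pow i by simp
    have "orbit p (offset \<pi> a + i) = {(p ^^ t) (offset \<pi> a + i) |t. t < \<pi> ! a}"
      using per i by (intro orbit_altdef_bounded) auto
    also have "\<dots> = B a"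
    proof (intro equalityI subsetI)
      fix v assume "v \<in> {(p ^^ t) (offset \<pi> a + i) |t. t < \<pi> ! a}"
      then show "v \<in> B a"
        using i a by (auto simp: pow B_def offset_Suc)
    next
      fix v assume "v \<in> B a"
      then obtain j where j: "j < \<pi> ! a" "v = offset \<pi> a + j"
        using a that by (auto simp: B_def offset_Suc dest!: le_Suc_ex)
      define t where "t = (if i \<le> j then j - i else \<pi> ! a + j - i)"
      have "t < \<pi> ! a" "(i + t) mod \<pi> ! a = j"
        using i j by (auto simp: t_def)
      then show "v \<in> {(p ^^ t) (offset \<pi> a + i) |t. t < \<pi> ! a}"
        using j(2) pow by auto
    qed
    finally show ?thesis .
  qed
  have "orbit p ` {0..<sum_list \<pi>} = B ` {0..<length \<pi>}"
  proof (intro equalityI subsetI)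
    fix C assume "C \<in> orbit p ` {0..<sum_list \<pi>}"
    then obtain v where v: "v < offset \<pi> (length \<pi>)" "C = orbit p v"
      by auto
    obtain a i where "a < length \<pi>" "i < \<pi> ! a" "v = offset \<pi> a + i"
      using offset_block[OF order.refl v(1)] by blast
    then show "C \<in> B ` {0..<length \<pi>}"
      using v(2) orb by auto
  next
    fix C assume "C \<in> B ` {0..<length \<pi>}"
    then obtain a where a: "a < length \<pi>" "C = B a" by auto
    have "offset \<pi> a < sum_list \<pi>"
      using offset_strict_mono[OF pos a(1) order.refl] by simp
    moreover have "0 < \<pi> ! a"
      using pos a(1) by simp
    ultimately show "C \<in> orbit p ` {0..<sum_list \<pi>}"
      using orb[OF a(1), of 0] a(2) by (intro image_eqI[of _ _ "offset \<pi> a"]) auto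
  qed
  moreover have "inj_on B {0..<length \<pi>}"
  proof (rule inj_onI)
    fix a b assume ab: "a \<in> {0..<length \<pi>}" "b \<in> {0..<length \<pi>}" "B a = B b"
    have "offset \<pi> a < offset \<pi> (Suc a)" "offset \<pi> b < offset \<pi> (Suc b)"
      using ab by (auto intro!: offset_strict_mono[OF pos])
    then have "offset \<pi> a \<in> B b" "offset \<pi> b \<in> B a"
      using ab(3) by (auto simp: B_def)
    then have "offset \<pi> a = offset \<pi> b"
      by (simp add: B_def)
    then show "a = b"
      using offset_strict_mono[OF pos, of a b] offset_strict_mono[OF pos, of b a] ab
      by (cases a b rule: linorder_cases) auto
  qed
  ultimately have "mset_set (orbit p ` {0..<sum_list \<pi>}) = image_mset B (mset_set {0..<length \<pi>})"
    by (simp add: image_mset_mset_set)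
  then have "image_mset card (mset_set (orbit p ` {0..<sum_list \<pi>})) =
      image_mset (\<lambda>a. card (B a)) (mset_set {0..<length \<pi>})"
    by (simp add: image_mset.compositionality comp_def)
  also have "\<dots> = image_mset (\<lambda>a. \<pi> ! a) (mset_set {0..<length \<pi>})"
    by (intro image_mset_cong) (auto simp: B_def offset_Suc)
  also have "\<dots> = mset (map (\<lambda>a. \<pi> ! a) [0..<length \<pi>])"
    by simp
  finally show ?thesis
    by (simp only: map_nth)
qed

definition block_ends :: "nat list \<Rightarrow> nat list" where
  "block_ends \<pi> = map (\<lambda>a. offset \<pi> (Suc a) - 1) [0..<length \<pi>]"

text \<open>
  These edges are to be appended to the path \<open>0 \<rightarrow> 1 \<rightarrow> \<dots> \<rightarrow> r\<close>, whose transpositions compose to the cycle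
  \<open>v \<mapsto> v + 1\<close> on all vertices. Being at the end of the list, the edges between the block ends act
  first. They send the end of each block to the end of the preceding block (cyclically), from
  where the long cycle continues to the start of the original block. So the long cycle breaks
  up into one cycle for each block. The \<open>2 k\<close> parallel edges cancel in pairs.
\<close>

definition partition_edges :: "nat list \<Rightarrow> nat \<Rightarrow> (nat \<times> nat) list" where
  "partition_edges \<pi> k =
     (let es = rev (block_ends \<pi>) in zip (tl es) es @ replicate (2 * k) (0, 1))"

lemma length_block_ends [simp]: "length (block_ends \<pi>) = length \<pi>"
  by (simp add: block_ends_def)

lemma block_ends_nth: "a < length \<pi> \<Longrightarrow> block_ends \<pi> ! a = offset \<pi> (Suc a) - 1"
  by (simp add: block_ends_def)

lemma block_ends_sorted:
  assumes pos: "\<forall>k\<in>set \<pi>. 0 < k"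
  shows "sorted_wrt (<) (block_ends \<pi>)"
  unfolding sorted_wrt_iff_nth_less
proof (intro allI impI)
  fix a b assume ab: "a < b" "b < length (block_ends \<pi>)"
  then have "0 < offset \<pi> (Suc a)" "offset \<pi> (Suc a) < offset \<pi> (Suc b)"
    using offset_strict_mono[OF pos, of 0 "Suc a"] offset_strict_mono[OF pos, of "Suc a" "Suc b"] by auto
  then show "block_ends \<pi> ! a < block_ends \<pi> ! b"
    using ab by (simp add: block_ends_nth)
qed

lemma swaps_partition_edges:
  assumes pos: "\<forall>k\<in>set \<pi>. 0 < k" and sum: "sum_list \<pi> = Suc r"
    and a: "a < length \<pi>" and i: "i < \<pi> ! a"
  shows "swaps (map (\<lambda>i. (i, Suc i)) [0..<r] @ partition_edges \<pi> k) (offset \<pi> a + i)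
    = offset \<pi> a + Suc i mod \<pi> ! a"
proof -
  let ?es = "block_ends \<pi>" and ?l = "length \<pi>" and ?v = "offset \<pi> a + i"
  have ds: "distinct ?es"
    using block_ends_sorted[OF pos] by (simp add: strict_sorted_iff)
  have path: "swaps (map (\<lambda>i. (i, Suc i)) [0..<r]) = cycle_of_list [0..<Suc r]"
  proof -
    have "map (\<lambda>i. (i, Suc i)) [0..<r] = zip [0..<Suc r] (tl [0..<Suc r])"
      by (intro nth_equalityI) (auto simp: nth_tl simp del: upt_Suc)
    then show ?thesis by (simp only: swaps_zip_tl)
  qed
  have step: "cycle_of_list [0..<Suc r] v = (if v < r then Suc v else 0)" if "v \<le> r" for v
    using cycle_of_list_nth[of "[0..<Suc r]" v] that by (auto simp del: upt_Suc simp: nth_upt)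
  have P: "swaps (map (\<lambda>i. (i, Suc i)) [0..<r] @ partition_edges \<pi> k) v =
      cycle_of_list [0..<Suc r] (cycle_of_list (rev ?es) v)" for v
    by (simp add: partition_edges_def Let_def swaps_append path swaps_zip_tl_flipped swaps_replicate_even del: upt_Suc)
  have le: "offset \<pi> b \<le> Suc r" if "b \<le> ?l" for b
    using offset_mono[OF that order.refl] sum by simp
  have pos_end: "0 < offset \<pi> (Suc b)" if "b < ?l" for b
    using offset_strict_mono[OF pos, of 0 "Suc b"] that by simp
  show ?thesis
  proof (cases "Suc i = \<pi> ! a")
    case True
    \<comment> \<open>In the reversed list the end of block \<open>a\<close> is followed by the end of block \<open>a - 1\<close>.\<close>
    then have v: "?v = rev ?es ! (?l - Suc a)"
      using a by (simp add: rev_nth block_ends_nth offset_Suc)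
    have "cycle_of_list (rev ?es) ?v = rev ?es ! (Suc (?l - Suc a) mod ?l)"
      unfolding v using cycle_of_list_nth[of "rev ?es" "?l - Suc a"] ds a by simp
    also have "\<dots> = (if a = 0 then r else offset \<pi> a - 1)"
    proof (cases "a = 0")
      case True
      then show ?thesis
        using a sum by (simp add: rev_nth block_ends_nth)
    next
      case False
      then have "Suc (?l - Suc a) mod ?l = ?l - a"
        using a by simp
      then show ?thesis
        using a False by (simp add: rev_nth block_ends_nth)
    qed
    finally show ?thesis
    proof (cases "a = 0")
      case False
      then have "0 < offset \<pi> a" "offset \<pi> a < Suc r"
        using offset_strict_mono[OF pos, of a ?l] pos_end[of "a - 1"] a sum by auto
      then show "cycle_of_list (rev ?es) ?v = (if a = 0 then r else offset \<pi> a - 1) \<Longrightarrow> ?thesis"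
        using True False by (simp add: P step del: upt_Suc)
    qed (use True in \<open>simp add: P step del: upt_Suc\<close>)
  next
    case False
    have lt: "Suc ?v < offset \<pi> (Suc a)"
      using False i a by (simp add: offset_Suc)
    have "?v \<notin> set ?es"
    proof
      assume "?v \<in> set ?es"
      then obtain b where b: "b < ?l" "?v = offset \<pi> (Suc b) - 1"
        by (auto simp: in_set_conv_nth block_ends_nth)
      then have e: "Suc ?v = offset \<pi> (Suc b)"
        using pos_end[OF b(1)] by simp
      show False
      proof (cases "b < a")
        case True
        then have "offset \<pi> (Suc b) \<le> offset \<pi> a"
          using a by (intro offset_mono) auto
        then show False using e by simp
      next
        case False
        then have "offset \<pi> (Suc a) \<le> offset \<pi> (Suc b)"
          using b(1) by (intro offset_mono) auto
        then show False using e lt by simp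
      qed
    qed
    then have "cycle_of_list (rev ?es) ?v = ?v"
      by (intro id_outside_supp) simp
    moreover have "?v < r"
      using lt le[of "Suc a"] a by simp
    ultimately show ?thesis
      using False i by (simp add: P step del: upt_Suc)
  qed
qed

lemma partition_edges_bounds:
  assumes pos: "\<forall>k\<in>set \<pi>. 0 < k" and sum: "sum_list \<pi> = Suc r" and r: "0 < r"
    and e: "e \<in> set (partition_edges \<pi> k)"
  shows "fst e < snd e \<and> snd e \<le> r"
proof -
  let ?es = "rev (block_ends \<pi>)"
  consider "e = (0, 1)" | "e \<in> set (zip (tl ?es) ?es)"
    using e by (auto simp: partition_edges_def Let_def)
  then show ?thesis
  proof cases
    case 2
    then obtain j where j: "j < length (tl ?es)" "e = (tl ?es ! j, ?es ! j)"
      by (auto simp: set_zip)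
    have "sorted_wrt (\<lambda>x y. y < x) ?es"
      using block_ends_sorted[OF pos] by (simp add: sorted_wrt_rev)
    then have "?es ! Suc j < ?es ! j"
      using sorted_wrt_nth_less[of "\<lambda>x y. y < x" ?es j "Suc j"] j(1) by simp
    moreover have "?es ! j \<le> r"
    proof -
      have "?es ! j = offset \<pi> (Suc (length \<pi> - Suc j)) - 1"
        using j(1) by (simp add: rev_nth block_ends_nth)
      also have "\<dots> \<le> offset \<pi> (length \<pi>) - 1"
        using j(1) by (intro diff_le_mono offset_mono) auto
      finally show ?thesis using sum by simp
    qed
    ultimately show ?thesis
      using j by (simp add: nth_tl)
  qed (use r in auto)
qed

lemma length_partition_edges: "length (partition_edges \<pi> k) = (length \<pi> - 1) + 2 * k"
  by (simp add: partition_edges_def Let_def)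

lemma exists_quiver_with_cycle_type:
  assumes cn: "c < n" and \<pi>: "\<pi> \<in> P1 c (n - c + 1)"
  obtains Q :: "(nat, nat) pre_digraph" where "conn_loopless_quiver Q" "card (arcs Q) = n"
    "card (verts Q) = n - c + 1" "quiver_form Q \<in> UQuad_A c n" "quiver_cycle_type Q = \<pi>"
proof -
  define r where "r = n - c"
  have r: "0 < r" using cn by (simp add: r_def)
  have part: "partition_of (Suc r) \<pi>" and c: "int (length \<pi>) - 1 \<le> int c"
    "even (int c - (int (length \<pi>) - 1))"
    using \<pi> by (auto simp: P1_def r_def)
  have pos: "\<forall>k\<in>set \<pi>. 0 < k" and sum: "sum_list \<pi> = Suc r"
    using part by (auto simp: partition_of_def)
  have "\<pi> \<noteq> []" using sum by auto
  then have "0 < length \<pi>" by simp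
  then have "length \<pi> - 1 \<le> c" "even (c - (length \<pi> - 1))"
    using c by (auto simp: even_diff_nat)
  then obtain k where k: "c = (length \<pi> - 1) + 2 * k"
    by (metis add_diff_inverse_nat dvdE not_less)
  let ?fs = "partition_edges \<pi> k"
  let ?es = "map (\<lambda>i. (i, Suc i)) [0..<r] @ ?fs"
  let ?Q = "list_quiver (Suc r) ?es"
  have fs: "\<forall>e\<in>set ?fs. fst e < snd e \<and> snd e \<le> r"
    using partition_edges_bounds[OF pos sum r] by blast
  have Q: "conn_loopless_quiver ?Q" and UQ: "quiver_form ?Q \<in> UQuad_A c n"
    using path_quiver_form_in_UQuad_A[OF r fs] cn by (simp_all add: length_partition_edges k r_def)
  have arcs: "card (arcs ?Q) = n"
    using cn k by (simp add: length_partition_edges r_def)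
  then have ne: "arcs ?Q \<noteq> {}"
    using cn by (metis card.empty not_less0)
  have "mset (quiver_cycle_type ?Q) = image_mset card (mset_set (orbit (swaps ?es) ` {0..<sum_list \<pi>}))"
    unfolding mset_quiver_cycle_type[OF Q ne] by (simp add: sum)
  also have "\<dots> = mset \<pi>"
    using swaps_partition_edges[OF pos sum] by (intro orbit_cards_of_blocks pos)
  finally have "quiver_cycle_type ?Q = \<pi>"
    using partition_of_mset_inject[OF partition_of_quiver_cycle_type[OF Q ne] part] by simp
  then show thesis
    using that[OF Q arcs _ UQ] by (simp add: r_def)
qed

section \<open>The cycle type of a form\<close>

lemma tri_gram_unit_form:
  assumes "unit_form n q"
  shows "tri_gram n q \<in> carrier_mat n n" "det (tri_gram n q) = 1"
proof -
  have int: "integral_form n q" and unit: "\<And>i. i < n \<Longrightarrow> tri_gram n q $$ (i, i) = 1"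
    using assms by (auto simp: unit_form_def)
  note U = tri_gram_integral_form[OF int]
  show "tri_gram n q \<in> carrier_mat n n" by (rule U(1))
  show "det (tri_gram n q) = 1"
    using U(1,2) unit by (rule det_unitriangular)
qed

text \<open>
  From \<open>U' = B\<^sup>T U B\<close> one obtains \<open>\<Phi>' = B\<^sup>T \<Phi> (B\<^sup>T)\<^sup>-\<^sup>1\<close>.
\<close>

lemma coxeter_poly_strongly_congruent:
  assumes "unit_form n q" "unit_form n q'" and "strongly_congruent n q' q"
  shows "coxeter_poly n q' = coxeter_poly n q"
proof -
  let ?U = "tri_gram n q" and ?U' = "tri_gram n q'"
  obtain B where B: "B \<in> carrier_mat n n" "invertible_mat B" and U': "?U' = B\<^sup>T * ?U * B"
    using assms(3) by (auto simp: strongly_congruent_def)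
  obtain C where C: "C \<in> carrier_mat n n" "B * C = 1\<^sub>m n" "C * B = 1\<^sub>m n"
    using B by (rule invertible_matE)
  note U = tri_gram_unit_form[OF assms(1)] and Uc' = tri_gram_unit_form[OF assms(2)]
  note W = mat_inv_unimodular[OF U] and W' = mat_inv_unimodular[OF Uc']
  let ?W = "mat_inv ?U" and ?W' = "mat_inv ?U'"
  have BT: "B\<^sup>T \<in> carrier_mat n n" and CT: "C\<^sup>T \<in> carrier_mat n n" and UT: "?U\<^sup>T \<in> carrier_mat n n"
    and UT': "?U'\<^sup>T \<in> carrier_mat n n"
    using B(1) C(1) U(1) Uc'(1) by auto
  have BC: "B\<^sup>T * C\<^sup>T = 1\<^sub>m n" "C\<^sup>T * B\<^sup>T = 1\<^sub>m n"
    unfolding transpose_mult[OF C(1) B(1), symmetric] transpose_mult[OF B(1) C(1), symmetric] C(2,3)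
    by simp_all
  let ?X = "B\<^sup>T * (?U\<^sup>T * ?W) * C\<^sup>T"
  have UW: "?U\<^sup>T * ?W \<in> carrier_mat n n" using UT W(1) by (rule mult_carrier_mat)
  have X: "?X \<in> carrier_mat n n" by (rule mult_carrier_mat[OF mult_carrier_mat[OF BT UW] CT])
  have "?X * ?U' = B\<^sup>T * (?U\<^sup>T * ?W) * (C\<^sup>T * B\<^sup>T) * ?U * B"
    unfolding U' using BT CT UW U(1) B(1) by (simp add: assoc_mult_mat[of _ n n _ n _ n])
  also have "\<dots> = B\<^sup>T * ?U\<^sup>T * (?W * ?U) * B"
    unfolding BC using BT UT W(1) U(1) B(1) by (simp add: assoc_mult_mat[of _ n n _ n _ n])
  also have "\<dots> = ?U'\<^sup>T"
    unfolding W(3) U' using BT U(1) UT B(1)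
    by (simp add: transpose_mult[of _ n n _ n] assoc_mult_mat[of _ n n _ n _ n])
  finally have XU: "?X * ?U' = ?U'\<^sup>T" .
  have "?X = ?X * (?U' * ?W')"
    unfolding W'(2) by (rule right_mult_one_mat[OF X, symmetric])
  also have "\<dots> = ?X * ?U' * ?W'"
    using X Uc'(1) W'(1) by (rule assoc_mult_mat[symmetric])
  finally have eq: "?U'\<^sup>T * ?W' = ?X"
    unfolding XU by simp
  have "similar_mat (coxeter_mat n q') (coxeter_mat n q)"
  proof (rule similar_matI)
    show "{coxeter_mat n q', coxeter_mat n q, B\<^sup>T, C\<^sup>T} \<subseteq> carrier_mat n n"
      using UT W UT' W' BT CT by (simp add: coxeter_mat_def)
    show "coxeter_mat n q' = B\<^sup>T * coxeter_mat n q * C\<^sup>T"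
      unfolding coxeter_mat_def eq using B(1) C(1) U(1) W(1) by (simp del: assoc_mult_mat)
  qed (fact BC)+
  then show ?thesis
    unfolding coxeter_poly_def by (rule char_poly_similar)
qed

text \<open>
  The cycle type is well defined, because the Coxeter polynomial depends on the form only and the
  cycle type of a quiver can be recovered from it.
\<close>

lemma cycle_type_quiver:
  fixes Q :: "(nat, nat) pre_digraph"
  assumes cn: "c < n" and q: "q \<in> UQuad_A c n"
    and Q: "conn_loopless_quiver Q" "card (arcs Q) = n" "card (verts Q) = n - c + 1" "quiver_form Q = q"
  shows "cycle_type n q = quiver_cycle_type Q"
  unfolding cycle_type_def
proof (rule the_equality)
  have cork: "corank n q = c"
    using q by (simp add: UQuad_A_def)
  then show "\<exists>Q' :: (nat, nat) pre_digraph. conn_loopless_quiver Q' \<and> card (arcs Q') = n \<and>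
      card (verts Q') = n - corank n q + 1 \<and> quiver_form Q' = q \<and> quiver_cycle_type Q = quiver_cycle_type Q'"
    using Q by blast
  fix \<pi> assume "\<exists>Q' :: (nat, nat) pre_digraph. conn_loopless_quiver Q' \<and> card (arcs Q') = n \<and>
      card (verts Q') = n - corank n q + 1 \<and> quiver_form Q' = q \<and> \<pi> = quiver_cycle_type Q'"
  then obtain Q' :: "(nat, nat) pre_digraph" where Q': "conn_loopless_quiver Q'" "card (arcs Q') = n"
    "card (verts Q') = n - c + 1" "quiver_form Q' = q" "\<pi> = quiver_cycle_type Q'"
    using cork by auto
  have ne: "arcs Q \<noteq> {}" "arcs Q' \<noteq> {}"
    using Q(2) Q'(2) cn by auto
  have "[:-1, 1:] ^ n * char_partition \<pi> = [:-1, 1:] ^ n * char_partition (quiver_cycle_type Q)"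
    using coxeter_poly_quiver_form[OF Q(1) ne(1)] coxeter_poly_quiver_form[OF Q'(1) ne(2)]
    by (simp add: Q Q')
  then have "char_partition \<pi> = char_partition (quiver_cycle_type Q)"
    by simp
  then show "\<pi> = quiver_cycle_type Q"
    using partition_of_quiver_cycle_type[OF Q(1) ne(1)] partition_of_quiver_cycle_type[OF Q'(1) ne(2)]
    unfolding Q'(5) by (intro char_partition_inject)
qed

lemma cycle_type_UQuad_A:
  assumes cn: "c < n" and q: "q \<in> UQuad_A c n"
  shows "cycle_type n q \<in> P1 c (n - c + 1)"
    "[:-1, 1:] ^ (n - c + 1) * coxeter_poly n q = [:-1, 1:] ^ n * char_partition (cycle_type n q)"
proof -
  obtain Q :: "(nat, nat) pre_digraph" where Q: "conn_loopless_quiver Q" "card (arcs Q) = n"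
    "card (verts Q) = n - c + 1" "quiver_form Q = q"
    using UQuad_A_quiver[OF cn q] .
  have ne: "arcs Q \<noteq> {}"
    using Q(2) cn by auto
  note ct = cycle_type_quiver[OF cn q Q]
  show "cycle_type n q \<in> P1 c (n - c + 1)"
    using quiver_cycle_type_in_P1[OF Q(1) ne] cn by (simp add: ct Q)
  show "[:-1, 1:] ^ (n - c + 1) * coxeter_poly n q = [:-1, 1:] ^ n * char_partition (cycle_type n q)"
    using coxeter_poly_quiver_form[OF Q(1) ne] by (simp add: ct Q)
qed

theorem mainTheorem1:
  fixes c n :: nat
  assumes "c < n"
  shows "cycle_type n ` UQuad_A c n = P1 c (n - c + 1) \<and>
    (\<forall>q \<in> UQuad_A c n. \<forall>q' \<in> UQuad_A c n.
       strongly_congruent n q' q \<longrightarrow> cycle_type n q' = cycle_type n q) \<and>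
    (\<forall>q \<in> UQuad_A c n.
       coxeter_poly n q =
         (if c = 0 then char_partition (cycle_type n q) div [:-1, 1:]
          else [:-1, 1:] ^ (c - 1) * char_partition (cycle_type n q)))"
proof (intro conjI ballI impI)
  note ct = cycle_type_UQuad_A[OF assms]
  show "cycle_type n ` UQuad_A c n = P1 c (n - c + 1)"
  proof (intro equalityI subsetI)
    fix \<pi> assume "\<pi> \<in> P1 c (n - c + 1)"
    then obtain Q :: "(nat, nat) pre_digraph" where Q: "conn_loopless_quiver Q" "card (arcs Q) = n"
      "card (verts Q) = n - c + 1" "quiver_form Q \<in> UQuad_A c n" "quiver_cycle_type Q = \<pi>"
      using exists_quiver_with_cycle_type[OF assms] by blast
    have "cycle_type n (quiver_form Q) = \<pi>"
      using cycle_type_quiver[OF assms Q(4,1,2,3) refl] Q(5) by simp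
    then show "\<pi> \<in> cycle_type n ` UQuad_A c n"
      using Q(4) by blast
  qed (use ct(1) in auto)
next
  note ct = cycle_type_UQuad_A[OF assms]
  fix q q' assume q: "q \<in> UQuad_A c n" "q' \<in> UQuad_A c n" and sc: "strongly_congruent n q' q"
  have "coxeter_poly n q' = coxeter_poly n q"
    using q sc by (intro coxeter_poly_strongly_congruent) (auto simp: UQuad_A_def)
  then have "[:-1, 1:] ^ n * char_partition (cycle_type n q') = [:-1, 1:] ^ n * char_partition (cycle_type n q)"
    using ct(2)[OF q(1)] ct(2)[OF q(2)] by simp
  then have "char_partition (cycle_type n q') = char_partition (cycle_type n q)"
    by simp
  then show "cycle_type n q' = cycle_type n q"
    using ct(1)[OF q(1)] ct(1)[OF q(2)] by (auto simp: P1_def intro: char_partition_inject)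
next
  fix q assume q: "q \<in> UQuad_A c n"
  let ?x = "[:-1, 1:] :: int poly" and ?\<chi> = "char_partition (cycle_type n q)"
  note eq = cycle_type_UQuad_A(2)[OF assms q]
  have nz: "?x ^ k \<noteq> 0" for k
    by simp
  show "coxeter_poly n q = (if c = 0 then ?\<chi> div ?x else ?x ^ (c - 1) * ?\<chi>)"
  proof (cases "c = 0")
    case True
    have "?x ^ n * (?x * coxeter_poly n q) = ?x ^ n * ?\<chi>"
      using eq True by (simp only: diff_zero power_add power_one_right mult.assoc)
    then have "?x * coxeter_poly n q = ?\<chi>"
      using nz by (metis mult_left_cancel)
    then have "?\<chi> div ?x = coxeter_poly n q"
      by (metis nonzero_mult_div_cancel_left pCons_eq_0_iff zero_neq_one)
    then show ?thesis
      using True by simp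
  next
    case False
    then have "n = (n - c + 1) + (c - 1)"
      using assms by simp
    then have "?x ^ (n - c + 1) * coxeter_poly n q = ?x ^ (n - c + 1) * (?x ^ (c - 1) * ?\<chi>)"
      using eq by (metis power_add mult.assoc)
    then have "coxeter_poly n q = ?x ^ (c - 1) * ?\<chi>"
      using nz by (metis mult_left_cancel)
    then show ?thesis
      using False by simp
  qed
qed

end
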